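(* Let $0<\mu\le\mu_{\max}$. Let $P_0\in L^1(\mathbb R)\cap H^1(\mathbb R)$ be such that $\widehat{P_0}(0)\ne0$. Consider the amplitude $\zeta_R$ created by the pressure $P(t,X)=P_0(X-t)$, defined by $$\widehat{\zeta_R}(t,\xi)=-\frac i2\,\xi\,\omega(\sqrt\mu\,\xi)\,\widehat{P_0}(\xi)\,e^{-it\xi}\int_{-t}^0e^{is\xi(\omega(\sqrt\mu\,\xi)-1)}\,ds .$$ Then $$|\zeta_R(t,\cdot)|_\infty\le C(\mu_{\max})\left(\frac{t^{\frac13}}{\mu}|P_0|_{L^1}+\mu^{\frac14}|P_0|_{H^1}\right).$$ Furthermore, if $XP_0\in H^1(\mathbb R)$, $$\liminf_{t\to+\infty}\left|\frac1{t^{1/3}}\zeta_R(t,\cdot)\right|_\infty\ge\frac C{\mu^{\frac23}}\left|\widehat{P_0}(0)\right| .$$ Here $C(\mu_{\max})$ depends only on $\mu_{\max}$ and $C>0$ is a universal constant.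
   Context: $\omega(\xi)=\sqrt{\frac{\tanh\xi}{\xi}}$ (with $\omega(0)=1$); $\widehat{\ }$ is the Fourier transform in $X\in\mathbb R$, with inversion written $g(X)=\int_{\mathbb R}e^{iX\xi}\widehat g(\xi)d\xi$; $XP_0$ denotes the function $X\mapsto XP_0(X)$; $|\cdot|_\infty$ is the $L^\infty(\mathbb R)$ norm; $t>0$. *)

theory Defs
  imports "HOL-Probability.Probability"
begin

definition omega :: "real \<Rightarrow> real" where
  "omega \<xi> = (if \<xi> = 0 then 1 else sqrt (tanh \<xi> / \<xi>))"

(* The normalization 1 / (2 pi) is the one for which the inversion formula carries no constant,
   as in inv_fourier below. *)
definition fourier :: "(real \<Rightarrow> complex) \<Rightarrow> real \<Rightarrow> complex" where
  "fourier f \<xi> = (LINT X|lebesgue. cis (- (X * \<xi>)) * f X) / of_real (2 * pi)"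

definition inv_fourier :: "(real \<Rightarrow> complex) \<Rightarrow> real \<Rightarrow> complex" where
  "inv_fourier h X = (LINT \<xi>|lebesgue. cis (X * \<xi>) * h \<xi>)"

definition in_L2 :: "(real \<Rightarrow> complex) \<Rightarrow> bool" where
  "in_L2 f \<longleftrightarrow> f \<in> borel_measurable lebesgue \<and> integrable lebesgue (\<lambda>x. (cmod (f x))\<^sup>2)"

definition test_function :: "(real \<Rightarrow> real) \<Rightarrow> bool" where
  "test_function \<phi> \<longleftrightarrow>
     (\<forall>n x. (deriv ^^ n) \<phi> differentiable (at x)) \<and> compact (closure {x. \<phi> x \<noteq> 0})"

(* The distributional derivative of f is represented by an L2 function g. This is only used
   for f in L2, in which case both integrals converge absolutely. *)
definition has_L2_weak_deriv :: "(real \<Rightarrow> complex) \<Rightarrow> (real \<Rightarrow> complex) \<Rightarrow> bool" where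
  "has_L2_weak_deriv f g \<longleftrightarrow> in_L2 g \<and>
     (\<forall>\<phi>. test_function \<phi> \<longrightarrow>
        (LINT x|lebesgue. deriv \<phi> x *\<^sub>R f x) = - (LINT x|lebesgue. \<phi> x *\<^sub>R g x))"

definition in_H1 :: "(real \<Rightarrow> complex) \<Rightarrow> bool" where
  "in_H1 f \<longleftrightarrow> in_L2 f \<and> (\<exists>g. has_L2_weak_deriv f g)"

(* Weak derivatives are unique almost everywhere, so the norm does not depend on the choice. *)
definition weak_deriv :: "(real \<Rightarrow> complex) \<Rightarrow> real \<Rightarrow> complex" where
  "weak_deriv f = (SOME g. has_L2_weak_deriv f g)"

definition L1_norm :: "(real \<Rightarrow> complex) \<Rightarrow> real" where
  "L1_norm f = (LINT x|lebesgue. cmod (f x))"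

definition H1_norm :: "(real \<Rightarrow> complex) \<Rightarrow> real" where
  "H1_norm f = sqrt ((LINT x|lebesgue. (cmod (f x))\<^sup>2) + (LINT x|lebesgue. (cmod (weak_deriv f x))\<^sup>2))"

definition Linf_norm :: "(real \<Rightarrow> complex) \<Rightarrow> ereal" where
  "Linf_norm f = esssup lebesgue (\<lambda>x. ereal (cmod (f x)))"

definition zeta_hat :: "real \<Rightarrow> (real \<Rightarrow> complex) \<Rightarrow> real \<Rightarrow> real \<Rightarrow> complex" where
  "zeta_hat \<mu> P0 t \<xi> =
     - (\<i> / 2) * of_real (\<xi> * omega (sqrt \<mu> * \<xi>)) * fourier P0 \<xi> * cis (- (t * \<xi>))
       * integral {-t..0} (\<lambda>s. cis (s * \<xi> * (omega (sqrt \<mu> * \<xi>) - 1)))"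

(* For P0 in both L1 and H1 the function zeta_hat mu P0 t is integrable: at high frequency it is
   of size |xi| powr (-1/2) times fourier P0, and xi * fourier P0 is in L2. Hence the inversion
   integral converges absolutely and zeta_R is the function with Fourier transform zeta_hat. *)
definition zeta_R :: "real \<Rightarrow> (real \<Rightarrow> complex) \<Rightarrow> real \<Rightarrow> real \<Rightarrow> complex" where
  "zeta_R \<mu> P0 t = inv_fourier (zeta_hat \<mu> P0 t)"

end

theory Submission
  imports Defs "HOL-Real_Asymp.Real_Asymp"
begin

text \<open>
  With \<open>b = \<xi> (\<omega>(\<surd>\<mu> \<xi>) - 1)\<close>, the oscillating integral in the definition of \<open>zeta_hat\<close> is bounded by
  \<open>min(t, 2 / |b|)\<close>. As \<open>1 - \<omega>(x)\<close> is at least \<open>x\<^sup>2 / 24\<close> for \<open>|x| \<le> 1\<close>, the low frequencies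
  \<open>\<surd>\<mu> |\<xi>| \<le> 1\<close> contribute at most a constant times \<open>t / L\<^sup>2\<close>, where \<open>L = (\<mu> t)^(1/3)\<close> is the scale
  at which the two terms of the minimum balance; no dispersive estimate is needed. At high
  frequencies \<open>zeta_hat\<close> is of size \<open>\<omega>(\<surd>\<mu> \<xi>)\<close> times the transform of \<open>P0\<close>, and Cauchy-Schwarz
  reduces the bound to square integrability of \<open>\<xi>\<close> times the transform of \<open>P0\<close>. The latter follows
  from Bessel's inequality, which Gaussian regularisation and Fubini give, applied to the weak
  derivative multiplied by smooth cutoffs.

  For the lower bound, \<open>zeta_R\<close> is continuous, so its supremum dominates its value at \<open>X = t\<close>.
  After the substitution \<open>\<xi> = \<sigma> / L\<close> the low-frequency part divided by \<open>t^(1/3)\<close> converges by dominated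
  convergence to \<open>\<mu>^(-2/3)\<close> times the transform of \<open>P0\<close> at 0 times the integral of
  \<open>3 (1 - exp(i \<sigma>\<^sup>3 / 6)) / \<sigma>\<^sup>2\<close>, whose real part is positive, while the high-frequency part is bounded.
\<close>

section \<open>Smooth cutoff functions\<close>

definition smooth :: "(real \<Rightarrow> real) \<Rightarrow> bool" where
  "smooth f \<longleftrightarrow> (\<forall>n x. (deriv ^^ n) f differentiable (at x))"

text \<open>All iterated derivatives stay in a class \<open>A\<close> that is closed under
  \<open>deriv\<close>, so no formula for the n-th derivative is needed. The smoothness proofs below
  differ mainly in the choice of \<open>A\<close>.\<close>

lemma smoothI_closed:
  assumes "f \<in> A" and "\<And>g x. g \<in> A \<Longrightarrow> g differentiable (at x)" and "\<And>g. g \<in> A \<Longrightarrow> deriv g \<in> A"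
  shows "smooth f"
proof -
  have "(deriv ^^ n) f \<in> A" for n
    by (induction n) (use assms in auto)
  then show ?thesis using assms by (auto simp: smooth_def)
qed

lemma smooth_differentiable: "smooth f \<Longrightarrow> f differentiable (at x)"
  by (metis funpow_0 smooth_def)

lemma smooth_deriv: "smooth f \<Longrightarrow> smooth (deriv f)"
  unfolding smooth_def by (metis comp_apply funpow_Suc_right)

lemma smooth_DERIV: "smooth f \<Longrightarrow> DERIV f x :> deriv f x"
  using smooth_differentiable[of f x] by (simp add: DERIV_deriv_iff_real_differentiable)

lemma smooth_continuous: "smooth f \<Longrightarrow> continuous_on UNIV f"
  by (meson DERIV_continuous continuous_at_imp_continuous_on smooth_DERIV)

lemma smooth_affine:
  assumes "smooth f" shows "smooth (\<lambda>x. f (a * x + b))"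
proof (rule smoothI_closed)
  \<comment> \<open>The factor \<open>c\<close> absorbs the powers of \<open>a\<close> that the
    chain rule produces.\<close>
  let ?A = "{(\<lambda>x. c * g (a * x + b)) | c g. smooth g}"
  show "(\<lambda>x. f (a * x + b)) \<in> ?A"
    using assms by (auto intro!: exI[of _ 1] exI[of _ f])
  have D: "DERIV (\<lambda>x. c * g (a * x + b)) x :> (c * a) * deriv g (a * x + b)" if "smooth g" for c g x
    by (rule derivative_eq_intros DERIV_chain2[OF smooth_DERIV[OF that]] refl | simp)+
  show "g differentiable (at x)" if "g \<in> ?A" for g x
    using that D by (auto simp: real_differentiable_def)
  show "deriv g \<in> ?A" if g: "g \<in> ?A" for g
  proof -
    obtain c h where h: "smooth h" "g = (\<lambda>x. c * h (a * x + b))" using g by auto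
    have "deriv g = (\<lambda>x. (c * a) * deriv h (a * x + b))"
      unfolding h using D[OF h(1)] by (auto intro!: DERIV_imp_deriv)
    then show ?thesis using smooth_deriv[OF h(1)] by blast
  qed
qed

text \<open>The Leibniz rule turns one product into a sum of two, so the closed class behind
  \<open>smooth_mult\<close> consists of finite sums of products.\<close>

inductive_set product_sums :: "(real \<Rightarrow> real) set" where
  product: "smooth f \<Longrightarrow> smooth g \<Longrightarrow> (\<lambda>x. f x * g x) \<in> product_sums"
| sum: "u \<in> product_sums \<Longrightarrow> v \<in> product_sums \<Longrightarrow> (\<lambda>x. u x + v x) \<in> product_sums"

lemma smooth_mult:
  assumes "smooth f" "smooth g" shows "smooth (\<lambda>x. f x * g x)"
proof (rule smoothI_closed[of _ product_sums])
  show "(\<lambda>x. f x * g x) \<in> product_sums" using assms by (rule product_sums.product)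
  have *: "\<exists>u'\<in>product_sums. \<forall>x. DERIV u x :> u' x" if "u \<in> product_sums" for u
    using that
  proof induction
    case (product f g)
    have "DERIV (\<lambda>x. f x * g x) x :> deriv f x * g x + f x * deriv g x" for x
      using product by (auto intro!: derivative_eq_intros smooth_DERIV)
    then show ?case
      using product by (auto intro!: bexI[of _ "\<lambda>x. deriv f x * g x + f x * deriv g x"]
        product_sums.intros smooth_deriv)
  next
    case (sum u v)
    then obtain u' v' where "u' \<in> product_sums" "v' \<in> product_sums"
      "\<And>x. DERIV u x :> u' x" "\<And>x. DERIV v x :> v' x" by metis
    then show ?case
      by (auto intro!: bexI[of _ "\<lambda>x. u' x + v' x"] product_sums.intros derivative_eq_intros)
  qed
  show "u differentiable (at x)" if "u \<in> product_sums" for u x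
    using *[OF that] by (auto simp: real_differentiable_def)
  show "deriv u \<in> product_sums" if u: "u \<in> product_sums" for u
  proof -
    obtain u' where "u' \<in> product_sums" "\<forall>x. DERIV u x :> u' x" using *[OF u] by auto
    moreover from this have "deriv u = u'" by (auto intro!: DERIV_imp_deriv)
    ultimately show ?thesis by simp
  qed
qed

section \<open>Smoothness of cosine and sine\<close>

lemma smooth_cos: "smooth cos" and smooth_sin: "smooth sin"
proof -
  \<comment> \<open>The span of \<open>cos\<close> and \<open>sin\<close> is closed under
    differentiation, which only exchanges the coefficients up to sign.\<close>
  let ?A = "range (\<lambda>(a,b) x. a * cos x + b * sin x) :: (real \<Rightarrow> real) set"
  have D: "DERIV (\<lambda>x. a * cos x + b * sin x) x :> b * cos x + (- a) * sin x" for a b x :: real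
    by (auto intro!: derivative_eq_intros)
  have 1: "g differentiable (at x)" if "g \<in> ?A" for g x
    using that D by (auto simp: real_differentiable_def)
  have 2: "deriv g \<in> ?A" if g: "g \<in> ?A" for g
  proof -
    obtain a b where h: "g = (\<lambda>x. a * cos x + b * sin x)" using g by auto
    have "deriv g = (\<lambda>x. b * cos x + (- a) * sin x)"
      unfolding h using D by (auto intro!: DERIV_imp_deriv)
    then show ?thesis by (auto intro!: image_eqI[of _ _ "(b, -a)"])
  qed
  show "smooth cos" 
    by (rule smoothI_closed[of _ ?A]) (auto intro!: image_eqI[of _ _ "(1,0)"] 1 2[simplified])
  show "smooth sin" 
    by (rule smoothI_closed[of _ ?A]) (auto intro!: image_eqI[of _ _ "(0,1)"] 1 2[simplified])
qed

section \<open>A smooth bump function built from exp(-1/x)\<close>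

definition exp_inverse_poly :: "real poly \<Rightarrow> real \<Rightarrow> real" where
  "exp_inverse_poly p x = (if x > 0 then exp (- inverse x) * poly p (inverse x) else 0)"

lemma poly_div_exp_tendsto_0: "((\<lambda>y. exp (- y) * poly p y) \<longlongrightarrow> 0) at_top" for p :: "real poly"
proof -
  have "((\<lambda>y. \<Sum>i\<le>degree p. coeff p i * (y ^ i / exp y)) \<longlongrightarrow> (\<Sum>i\<le>degree p. coeff p i * 0)) at_top"
    by (intro tendsto_intros tendsto_power_div_exp_0)
  then show ?thesis
    by (simp add: poly_altdef exp_minus field_simps sum_divide_distrib)
qed

text \<open>With y = 1/x, differentiating exp(-y) p(y) in x multiplies the y-derivative by -y^2 and
  gives y^2 (p - p')(y) exp(-y), which has the same form; \<open>[:0, 0, 1:]\<close> is y^2. At 0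
  the exponential decay beats every polynomial in y.\<close>

lemma exp_inverse_poly_DERIV:
  "DERIV (exp_inverse_poly p) x :> exp_inverse_poly ([:0, 0, 1:] * (p - pderiv p)) x"
proof (cases x "0::real" rule: linorder_cases)
  case less
  then have "DERIV (\<lambda>x. 0) x :> exp_inverse_poly ([:0, 0, 1:] * (p - pderiv p)) x"
    by (simp add: exp_inverse_poly_def)
  moreover have "eventually (\<lambda>y. exp_inverse_poly p y = 0) (nhds x)"
    using eventually_nhds_in_open[of "{..<0}" x] less
    by (auto elim!: eventually_mono simp: exp_inverse_poly_def)
  ultimately show ?thesis by (subst DERIV_cong_ev[OF refl _ refl])
next
  case greater
  have "exp (- inverse x) * (inverse x)^2 * poly p (inverse x) + exp (- inverse x) * (poly (pderiv p) (inverse x) * (- ((inverse x)^2)))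
    = exp_inverse_poly ([:0, 0, 1:] * (p - pderiv p)) x"
    using greater by (simp add: exp_inverse_poly_def algebra_simps power2_eq_square)
  moreover have "DERIV (\<lambda>x. exp (- inverse x) * poly p (inverse x)) x :>
    exp (- inverse x) * (inverse x)^2 * poly p (inverse x) + exp (- inverse x) * (poly (pderiv p) (inverse x) * (- ((inverse x)^2)))"
    using greater by (auto intro!: derivative_eq_intros DERIV_chain2[OF poly_DERIV] simp: power2_eq_square)
  ultimately have "DERIV (\<lambda>x. exp (- inverse x) * poly p (inverse x)) x :> exp_inverse_poly ([:0, 0, 1:] * (p - pderiv p)) x" by simp
  moreover have "eventually (\<lambda>y. exp_inverse_poly p y = exp (- inverse y) * poly p (inverse y)) (nhds x)"
    using eventually_nhds_in_open[of "{0<..}" x] greater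
    by (auto elim!: eventually_mono simp: exp_inverse_poly_def)
  ultimately show ?thesis by (subst DERIV_cong_ev[OF refl _ refl])
next
  case equal
  \<comment> \<open>The difference quotient at 0 divides by \<open>h\<close>, that is, it multiplies
    the polynomial by \<open>[:0, 1:]\<close>.\<close>
  have "((\<lambda>h. exp (- inverse h) * poly ([:0, 1:] * p) (inverse h)) \<longlongrightarrow> 0) (at_right 0)"
    by (rule filterlim_compose[OF poly_div_exp_tendsto_0 filterlim_inverse_at_top_right])
  then have R: "((\<lambda>h. exp_inverse_poly p h / h) \<longlongrightarrow> 0) (at_right 0)"
    by (rule Lim_transform_eventually)
       (auto simp: eventually_at_filter exp_inverse_poly_def field_simps)
  have L: "((\<lambda>h. exp_inverse_poly p h / h) \<longlongrightarrow> 0) (at_left 0)"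
    by (rule Lim_transform_eventually[OF tendsto_const])
       (auto simp: eventually_at_filter exp_inverse_poly_def)
  show ?thesis using filterlim_split_at_real[OF L R] unfolding equal
    by (simp add: DERIV_def exp_inverse_poly_def)
qed

lemma smooth_exp_inverse_poly: "smooth (exp_inverse_poly p)"
proof (rule smoothI_closed[of _ "range exp_inverse_poly"])
  show "g differentiable (at x)" if "g \<in> range exp_inverse_poly" for g x
    using that exp_inverse_poly_DERIV by (auto simp: real_differentiable_def)
  show "deriv g \<in> range exp_inverse_poly" if g: "g \<in> range exp_inverse_poly" for g
  proof -
    obtain p where p: "g = exp_inverse_poly p" using g by auto
    have "deriv g = exp_inverse_poly ([:0, 0, 1:] * (p - pderiv p))"
      unfolding p using exp_inverse_poly_DERIV by (auto intro!: DERIV_imp_deriv)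
    then show ?thesis by blast
  qed
qed auto

lemma smooth_bump_exists:
  "\<exists>\<eta>. smooth \<eta> \<and> \<eta> 0 = 1 \<and> (\<forall>x. 0 \<le> \<eta> x \<and> \<eta> x \<le> 1) \<and> (\<forall>x. \<bar>x\<bar> \<ge> 1 \<longrightarrow> \<eta> x = 0)"
proof (intro exI conjI allI impI)
  \<comment> \<open>The factors vanish for x >= 1 and for x <= -1 respectively; each
    \<open>exp 1\<close> cancels the value exp(-1) at 0.\<close>
  let ?c = "\<lambda>x. exp_inverse_poly [:exp 1:] ((-1) * x + 1) * exp_inverse_poly [:exp 1:] (1 * x + 1)"
  show "smooth ?c" by (intro smooth_mult smooth_affine smooth_exp_inverse_poly)
  show "?c 0 = 1" by (simp add: exp_inverse_poly_def exp_minus)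
  show "0 \<le> ?c x" for x by (simp add: exp_inverse_poly_def)
  show "?c x = 0" if "\<bar>x\<bar> \<ge> 1" for x using that by (auto simp: exp_inverse_poly_def)
  show "?c x \<le> 1" for x
  proof (cases "\<bar>x\<bar> < 1")
    case True
    \<comment> \<open>The exponents add up to 2 - 2 / (1 - x^2), which is at most 0; hence the
      product is at most 1.\<close>
    have "inverse (1 - x) + inverse (1 + x) = 2 / (1 - x\<^sup>2)"
      using True by (simp add: field_simps power2_eq_square)
    also have "\<dots> \<ge> 2" using True by (simp add: abs_square_less_1 le_divide_eq)
    finally have "exp (- inverse (1 - x) + 1 + (- inverse (1 + x) + 1)) \<le> 1" by simp
    then show ?thesis using True by (simp add: exp_inverse_poly_def exp_add[symmetric] add_ac)
  qed (auto simp: exp_inverse_poly_def)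
qed

section \<open>Bessel's inequality for the Fourier integral\<close>

text \<open>The Fourier integral without the factor 1 / (2 pi), taken over \<open>lborel\<close> so
  that the product kernels are Borel measurable and Fubini applies.\<close>

definition fint :: "(real \<Rightarrow> complex) \<Rightarrow> real \<Rightarrow> complex" where
  "fint f \<xi> = (LINT x|lborel. cis (- (x * \<xi>)) * f x)"

lemma cis_borel_measurable[measurable]: "cis \<in> borel_measurable borel"
  by (intro borel_measurable_continuous_onI continuous_intros)

lemma integrable_cis_mult:
  assumes "integrable lborel f" "h \<in> borel_measurable borel"
  shows "integrable lborel (\<lambda>x. cis (h x) * f x)"
proof -
  have [measurable]: "f \<in> borel_measurable borel" "h \<in> borel_measurable borel" using assms by auto
  show ?thesis
    by (rule Bochner_Integration.integrable_bound[OF assms(1)]) (auto simp: norm_mult)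
qed

lemma cmod_fint_le: "cmod (fint f \<xi>) \<le> (LINT x|lborel. cmod (f x))"
  unfolding fint_def using integral_norm_bound[of lborel "\<lambda>x. cis (- (x * \<xi>)) * f x"]
  by (simp add: norm_mult)

lemma isCont_fint:
  assumes "integrable lborel f" shows "isCont (fint f) \<xi>"
  unfolding continuous_at_sequentially comp_def
proof safe
  fix X assume X: "X \<longlonglongrightarrow> \<xi>"
  have [measurable]: "f \<in> borel_measurable borel" using assms by auto
  show "(\<lambda>n. fint f (X n)) \<longlonglongrightarrow> fint f \<xi>"
    unfolding fint_def
    by (rule integral_dominated_convergence[where w="\<lambda>x. cmod (f x)"])
       (auto simp: norm_mult assms X intro!: tendsto_intros tendsto_intros)
qed

lemma fint_measurable[measurable]:
  assumes "integrable lborel f" shows "fint f \<in> borel_measurable borel"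
  using isCont_fint[OF assms]
  by (intro borel_measurable_continuous_onI continuous_at_imp_continuous_on) auto

text \<open>Both sides are the double integral of one kernel whose phase is symmetric in
  \<open>x\<close> and \<open>\<xi>\<close> and whose modulus is the product of those of
  \<open>f x\<close> and \<open>g \<xi>\<close>, hence integrable on the plane.\<close>

lemma fint_mult_formula:
  assumes f: "integrable lborel f" and g: "integrable lborel g"
  shows "(LINT \<xi>|lborel. fint f \<xi> * g \<xi>) = (LINT x|lborel. f x * fint g x)"
proof -
  have [measurable]: "f \<in> borel_measurable borel" "g \<in> borel_measurable borel" using f g by auto
  let ?h = "\<lambda>x \<xi>. cis (- (x * \<xi>)) * f x * g \<xi>"
  have "integrable (lborel \<Otimes>\<^sub>M lborel) (case_prod ?h)"
  proof (rule lborel_pair.Fubini_integrable)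
    show "case_prod ?h \<in> borel_measurable (lborel \<Otimes>\<^sub>M lborel)" by measurable
    show "integrable lborel (\<lambda>x. LINT y|lborel. norm (case (x, y) of (x, xa) \<Rightarrow> ?h x xa))"
      using f by (simp add: norm_mult)
    show "AE x in lborel. integrable lborel (\<lambda>y. case (x, y) of (x, xa) \<Rightarrow> ?h x xa)"
    proof (rule AE_I2)
      fix x :: real
      have "integrable lborel (\<lambda>y. f x * (cis (- (x * y)) * g y))"
        by (intro integrable_mult_right integrable_cis_mult g) auto
      then show "integrable lborel (\<lambda>y. case (x, y) of (x, xa) \<Rightarrow> ?h x xa)"
        by (simp add: mult_ac)
    qed
  qed
  from lborel_pair.Fubini_integral[OF this]
  have "(LINT \<xi>|lborel. LINT x|lborel. ?h x \<xi>) = (LINT x|lborel. LINT \<xi>|lborel. ?h x \<xi>)" .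
  moreover have "(LINT x|lborel. ?h x \<xi>) = fint f \<xi> * g \<xi>" for \<xi>
    unfolding fint_def by simp
  moreover have "(LINT \<xi>|lborel. ?h x \<xi>) = f x * fint g x" for x
  proof -
    have "(LINT \<xi>|lborel. ?h x \<xi>) = (LINT \<xi>|lborel. f x * (cis (- (\<xi> * x)) * g \<xi>))"
      by (simp add: mult_ac)
    then show ?thesis unfolding fint_def by simp
  qed
  ultimately show ?thesis by (simp only:)
qed

section \<open>Fourier integrals of Gaussians\<close>

lemma gaussian_integral_cis:
  fixes e u :: real
  assumes "e > 0"
  shows "(LINT \<xi>|lborel. cis (u * \<xi>) * of_real (exp (- (e * \<xi>)\<^sup>2 / 2)))
    = of_real (2 * pi * normal_density 0 e u)" (is "?I = _")
proof -
  \<comment> \<open>The characteristic function of the standard normal law at \<open>u/e\<close>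
    becomes the wanted integral after the substitution \<open>x = e * \<xi>\<close>.\<close>
  have "of_real (exp (- (u/e)\<^sup>2 / 2)) = (LINT x|std_normal_distribution. iexp (u / e * x))"
    using fun_cong[OF char_std_normal_distribution, of "u/e"] by (simp add: char_def)
  also have "\<dots> = (LINT x|lborel. std_normal_density x *\<^sub>R iexp (u / e * x))"
    by (rule integral_density) auto
  also have "\<dots> = \<bar>e\<bar> *\<^sub>R (LINT x|lborel. std_normal_density (0 + e * x) *\<^sub>R iexp (u / e * (0 + e * x)))"
    using assms by (intro lborel_integral_real_affine) auto
  also have "(\<lambda>x. std_normal_density (0 + e * x) *\<^sub>R iexp (u / e * (0 + e * x)))
    = (\<lambda>\<xi>. of_real (1 / sqrt (2 * pi)) * (cis (u * \<xi>) * of_real (exp (- (e * \<xi>)\<^sup>2 / 2))))"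
    using assms by (auto simp: fun_eq_iff std_normal_density_def cis_conv_exp scaleR_conv_of_real)
  finally have "of_real (exp (- (u/e)\<^sup>2 / 2)) = of_real (e / sqrt (2 * pi)) * ?I"
    using assms by (simp add: scaleR_conv_of_real)
  then have "?I = of_real (sqrt (2 * pi) / e * exp (- (u/e)\<^sup>2 / 2))"
    using assms by (simp add: field_simps)
  also have "sqrt (2 * pi) / e * exp (- (u/e)\<^sup>2 / 2) = 2 * pi * normal_density 0 e u"
    using assms by (simp add: normal_density_def real_sqrt_mult field_simps power_divide)
  finally show ?thesis .
qed

lemma integrable_gaussian: "e > 0 \<Longrightarrow> integrable lborel (\<lambda>\<xi>::real. exp (- (e * \<xi>)\<^sup>2 / 2))"
proof -
  assume e: "e > 0"
  have "(\<lambda>\<xi>. exp (- (e * \<xi>)\<^sup>2 / 2)) = (\<lambda>\<xi>. sqrt (2 * pi) / e * normal_density 0 (1/e) \<xi>)"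
    using e by (auto simp: normal_density_def real_sqrt_mult real_sqrt_divide field_simps power_divide power_mult_distrib fun_eq_iff)
  moreover have "integrable lborel (\<lambda>\<xi>. sqrt (2 * pi) / e * normal_density 0 (1/e) \<xi>)"
    using e by (intro integrable_mult_right integrable_normal_density) auto
  ultimately show ?thesis by simp
qed

text \<open>For a non-integrable \<open>f\<close> the integral on the left is 0 by
  convention.\<close>

lemma norm_integral_le_nn_integral:
  fixes f :: "'a \<Rightarrow> 'b::{banach, second_countable_topology}"
  shows "ennreal (norm (integral\<^sup>L M f)) \<le> (\<integral>\<^sup>+x. ennreal (norm (f x)) \<partial>M)"
  by (cases "integrable M f") (auto intro: integral_norm_bound_ennreal simp: not_integrable_integral_eq)

text \<open>In the first identity the density has mass one in \<open>y\<close>; the second reduces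
  to it by Tonelli, as \<open>normal_density x e y\<close> is symmetric in \<open>x\<close> and
  \<open>y\<close>.\<close>

lemma nn_integral_normal_density_mult:
  assumes [measurable]: "h \<in> borel_measurable borel" and e: "e > 0"
  shows "(\<integral>\<^sup>+x. \<integral>\<^sup>+y. h x * ennreal (normal_density x e y) \<partial>lborel \<partial>lborel) = (\<integral>\<^sup>+x. h x \<partial>lborel)"
    and "(\<integral>\<^sup>+x. \<integral>\<^sup>+y. h y * ennreal (normal_density x e y) \<partial>lborel \<partial>lborel) = (\<integral>\<^sup>+x. h x \<partial>lborel)"
proof -
  have nd: "(\<integral>\<^sup>+y. ennreal (normal_density x e y) \<partial>lborel) = 1" for x
    using e by (subst nn_integral_eq_integral) auto
  have [measurable]: "(\<lambda>(x, y). normal_density x e y) \<in> borel_measurable (lborel \<Otimes>\<^sub>M lborel)"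
    unfolding normal_density_def by measurable
  show 1: "(\<integral>\<^sup>+x. \<integral>\<^sup>+y. h x * ennreal (normal_density x e y) \<partial>lborel \<partial>lborel) = (\<integral>\<^sup>+x. h x \<partial>lborel)"
    by (subst nn_integral_cmult) (auto simp: nd)
  have "(\<integral>\<^sup>+x. \<integral>\<^sup>+y. h y * ennreal (normal_density x e y) \<partial>lborel \<partial>lborel)
    = (\<integral>\<^sup>+y. \<integral>\<^sup>+x. h y * ennreal (normal_density x e y) \<partial>lborel \<partial>lborel)"
    by (rule lborel_pair.Fubini'[symmetric]) measurable
  also have "\<dots> = (\<integral>\<^sup>+y. \<integral>\<^sup>+x. h y * ennreal (normal_density y e x) \<partial>lborel \<partial>lborel)"
    by (simp add: normal_density_def power2_commute)
  finally show "(\<integral>\<^sup>+x. \<integral>\<^sup>+y. h y * ennreal (normal_density x e y) \<partial>lborel \<partial>lborel) = (\<integral>\<^sup>+x. h x \<partial>lborel)"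
    using 1 by simp
qed

text \<open>The Gaussian weight makes the pairing absolutely convergent. The multiplication formula
  turns the left side into a pairing of \<open>f\<close> with its own Gaussian average, times 2 pi,
  and AM-GM removes the average because its kernel has mass one. Nonnegative integrals allow the
  right side to be infinite.\<close>

lemma bessel_gaussian:
  assumes f: "integrable lborel f" and e: "e > 0"
  shows "(\<integral>\<^sup>+\<xi>. ennreal ((cmod (fint f \<xi>))\<^sup>2 * exp (- (e * \<xi>)\<^sup>2 / 2)) \<partial>lborel)
    \<le> ennreal (2 * pi) * (\<integral>\<^sup>+x. ennreal ((cmod (f x))\<^sup>2) \<partial>lborel)"
proof -
  note [measurable] = fint_measurable[OF f] borel_measurable_integrable[OF f]
  define w :: "real \<Rightarrow> complex" where "w \<xi> = of_real (exp (- (e * \<xi>)\<^sup>2 / 2))" for \<xi>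
  define B where "B = (LINT x|lborel. cmod (f x))"
  \<comment> \<open>Chosen so that \<open>fint f \<xi> * g \<xi>\<close> is the weighted square
    modulus of \<open>fint f\<close>.\<close>
  define g where "g \<xi> = cnj (fint f \<xi>) * w \<xi>" for \<xi>
  have B: "B \<ge> 0" unfolding B_def by simp
  have w: "integrable lborel w"
    unfolding w_def using integrable_gaussian[OF e] by auto
  have [measurable]: "w \<in> borel_measurable borel" "cnj \<in> borel_measurable borel"
    using w by (auto intro!: borel_measurable_continuous_onI continuous_intros)
  have cwm: "cmod (w \<xi>) = exp (- (e * \<xi>)\<^sup>2 / 2)" for \<xi>
    unfolding w_def by (simp only: norm_of_real abs_exp_cancel)
  have Bw: "integrable lborel (\<lambda>\<xi>. B * cmod (w \<xi>))" using w by auto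
  have FB: "cmod (fint f \<xi>) \<le> B" for \<xi> unfolding B_def by (rule cmod_fint_le)
  have g: "integrable lborel g"
  proof (rule Bochner_Integration.integrable_bound[OF Bw])
    show "g \<in> borel_measurable lborel" unfolding g_def[abs_def] by measurable
    show "AE \<xi> in lborel. norm (g \<xi>) \<le> norm (B * cmod (w \<xi>))"
      using B FB by (auto simp: g_def norm_mult abs_mult intro!: AE_I2 mult_right_mono)
  qed
  have cw: "integrable lborel (\<lambda>\<xi>. cis (\<xi> * x) * w \<xi>)" for x
    by (rule integrable_cis_mult[OF w]) auto
  have cwt: "fint (\<lambda>\<xi>. cis (\<xi> * x) * w \<xi>) y = of_real (2 * pi * normal_density x e y)" for x y
  proof -
    have "cis (- (\<xi> * y)) * (cis (\<xi> * x) * w \<xi>) = cis ((x - y) * \<xi>) * w \<xi>" for \<xi>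
      by (simp only: mult.assoc[symmetric] cis_mult) (simp add: algebra_simps)
    then have "fint (\<lambda>\<xi>. cis (\<xi> * x) * w \<xi>) y = (LINT \<xi>|lborel. cis ((x - y) * \<xi>) * w \<xi>)"
      unfolding fint_def by (simp only:)
    also have "\<dots> = of_real (2 * pi * normal_density 0 e (x - y))"
      unfolding w_def by (rule gaussian_integral_cis[OF e])
    also have "normal_density 0 e (x - y) = normal_density x e y"
      unfolding normal_density_def by (simp add: power2_commute)
    finally show ?thesis .
  qed
  \<comment> \<open>Up to conjugation and the factor 2 pi, the transform of \<open>g\<close> at
    \<open>x\<close> is the average of \<open>f\<close> against the normal density centred at
    \<open>x\<close>.\<close>
  have gt: "fint g x = cnj (LINT y|lborel. f y * of_real (2 * pi * normal_density x e y))" for x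
  proof -
    have "fint g x = (LINT \<xi>|lborel. cnj (fint f \<xi> * (cis (\<xi> * x) * w \<xi>)))"
      unfolding fint_def[of g] g_def by (simp add: w_def cis_cnj mult_ac)
    also have "\<dots> = cnj (LINT \<xi>|lborel. fint f \<xi> * (cis (\<xi> * x) * w \<xi>))"
      by (rule Bochner_Integration.integral_cnj)
    also have "\<dots> = cnj (LINT y|lborel. f y * of_real (2 * pi * normal_density x e y))"
      by (subst fint_mult_formula[OF f cw]) (simp only: cwt)
    finally show ?thesis .
  qed
  have ndm[measurable]: "(\<lambda>(x, y). normal_density x e y) \<in> borel_measurable (lborel \<Otimes>\<^sub>M lborel)"
    unfolding normal_density_def by measurable
  have "(\<integral>\<^sup>+\<xi>. ennreal ((cmod (fint f \<xi>))\<^sup>2 * exp (- (e * \<xi>)\<^sup>2 / 2)) \<partial>lborel)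
    = ennreal (LINT \<xi>|lborel. (cmod (fint f \<xi>))\<^sup>2 * exp (- (e * \<xi>)\<^sup>2 / 2))"
  proof (rule nn_integral_eq_integral)
    have "integrable lborel (\<lambda>\<xi>. B\<^sup>2 * exp (- (e * \<xi>)\<^sup>2 / 2))" using integrable_gaussian[OF e] by auto
    then show "integrable lborel (\<lambda>\<xi>. (cmod (fint f \<xi>))\<^sup>2 * exp (- (e * \<xi>)\<^sup>2 / 2))"
      by (rule Bochner_Integration.integrable_bound)
         (auto simp: abs_mult intro!: AE_I2 mult_right_mono power_mono FB)
  qed auto
  also have "(LINT \<xi>|lborel. (cmod (fint f \<xi>))\<^sup>2 * exp (- (e * \<xi>)\<^sup>2 / 2)) = cmod (LINT \<xi>|lborel. fint f \<xi> * g \<xi>)"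
  proof -
    have "fint f \<xi> * g \<xi> = of_real ((cmod (fint f \<xi>))\<^sup>2 * exp (- (e * \<xi>)\<^sup>2 / 2))" for \<xi>
      unfolding g_def w_def by (simp add: complex_norm_square[symmetric] mult.assoc[symmetric] del: of_real_power)
    then show ?thesis by (simp only: integral_complex_of_real norm_of_real)
       (intro abs_of_nonneg[symmetric] integral_nonneg, simp)
  qed
  also have "\<dots> = cmod (LINT x|lborel. f x * fint g x)"
    using fint_mult_formula[OF f g] by simp
  also have "ennreal \<dots> \<le> (\<integral>\<^sup>+x. ennreal (cmod (f x * fint g x)) \<partial>lborel)"
    by (rule norm_integral_le_nn_integral)
  also have "\<dots> \<le> (\<integral>\<^sup>+x. ennreal (2 * pi) * (\<integral>\<^sup>+y. (ennreal ((cmod (f x))\<^sup>2 / 2) * ennreal (normal_density x e y)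
      + ennreal ((cmod (f y))\<^sup>2 / 2) * ennreal (normal_density x e y)) \<partial>lborel) \<partial>lborel)"
  proof (rule nn_integral_mono)
    fix x :: real
    have "ennreal (cmod (f x * fint g x)) = ennreal (cmod (f x)) * ennreal (cmod (LINT y|lborel. f y * of_real (2 * pi * normal_density x e y)))"
      by (simp add: gt norm_mult ennreal_mult)
    also have "\<dots> \<le> ennreal (cmod (f x)) * (\<integral>\<^sup>+y. ennreal (cmod (f y * of_real (2 * pi * normal_density x e y))) \<partial>lborel)"
      by (intro mult_left_mono norm_integral_le_nn_integral) auto
    also have "\<dots> = (\<integral>\<^sup>+y. ennreal (cmod (f x)) * ennreal (cmod (f y * of_real (2 * pi * normal_density x e y))) \<partial>lborel)"
      by (rule nn_integral_cmult[symmetric]) measurable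
    also have "\<dots> \<le> (\<integral>\<^sup>+y. ennreal (2 * pi) * (ennreal ((cmod (f x))\<^sup>2 / 2) * ennreal (normal_density x e y)
      + ennreal ((cmod (f y))\<^sup>2 / 2) * ennreal (normal_density x e y)) \<partial>lborel)"
    proof (rule nn_integral_mono)
      fix y :: real
      \<comment> \<open>AM-GM separates \<open>x\<close> from \<open>y\<close>: each summand keeps a
        single value of \<open>f\<close>, and the kernel integrates to one in the other
        variable.\<close>
      have "cmod (f x) * cmod (f y) \<le> (cmod (f x))\<^sup>2 / 2 + (cmod (f y))\<^sup>2 / 2"
        using sum_squares_bound[of "cmod (f x)" "cmod (f y)"] by simp
      then have "cmod (f x) * cmod (f y) * (2 * pi * normal_density x e y)
        \<le> ((cmod (f x))\<^sup>2 / 2 + (cmod (f y))\<^sup>2 / 2) * (2 * pi * normal_density x e y)"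
        by (intro mult_right_mono) auto
      then show "ennreal (cmod (f x)) * ennreal (cmod (f y * of_real (2 * pi * normal_density x e y)))
        \<le> ennreal (2 * pi) * (ennreal ((cmod (f x))\<^sup>2 / 2) * ennreal (normal_density x e y)
          + ennreal ((cmod (f y))\<^sup>2 / 2) * ennreal (normal_density x e y))"
      proof -
        assume le: "cmod (f x) * cmod (f y) * (2 * pi * normal_density x e y)
          \<le> ((cmod (f x))\<^sup>2 / 2 + (cmod (f y))\<^sup>2 / 2) * (2 * pi * normal_density x e y)"
        have n: "cmod (f y * of_real (2 * pi * normal_density x e y)) = cmod (f y) * (2 * pi * normal_density x e y)"
          unfolding norm_mult norm_of_real by simp
        have "ennreal (cmod (f x)) * ennreal (cmod (f y * of_real (2 * pi * normal_density x e y)))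
          = ennreal (cmod (f x) * cmod (f y) * (2 * pi * normal_density x e y))"
          unfolding n by (subst ennreal_mult[symmetric]) (auto simp: mult.assoc)
        also have "\<dots> \<le> ennreal (((cmod (f x))\<^sup>2 / 2 + (cmod (f y))\<^sup>2 / 2) * (2 * pi * normal_density x e y))"
          by (rule ennreal_leI[OF le])
        also have "((cmod (f x))\<^sup>2 / 2 + (cmod (f y))\<^sup>2 / 2) * (2 * pi * normal_density x e y)
          = 2 * pi * ((cmod (f x))\<^sup>2 / 2 * normal_density x e y + (cmod (f y))\<^sup>2 / 2 * normal_density x e y)"
          by (simp add: algebra_simps)
        also have "ennreal \<dots> = ennreal (2 * pi) * (ennreal ((cmod (f x))\<^sup>2 / 2) * ennreal (normal_density x e y)
          + ennreal ((cmod (f y))\<^sup>2 / 2) * ennreal (normal_density x e y))"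
          by (subst ennreal_mult, simp, simp) (subst ennreal_plus, simp, simp, subst (1 2) ennreal_mult, auto)
        finally show ?thesis .
      qed
    qed
    also have "\<dots> = ennreal (2 * pi) * (\<integral>\<^sup>+y. (ennreal ((cmod (f x))\<^sup>2 / 2) * ennreal (normal_density x e y)
      + ennreal ((cmod (f y))\<^sup>2 / 2) * ennreal (normal_density x e y)) \<partial>lborel)"
      by (rule nn_integral_cmult) measurable
    finally show "ennreal (cmod (f x * fint g x)) \<le> \<dots>" .
  qed
  also have "\<dots> = ennreal (2 * pi) * (\<integral>\<^sup>+x. \<integral>\<^sup>+y. (ennreal ((cmod (f x))\<^sup>2 / 2) * ennreal (normal_density x e y)
      + ennreal ((cmod (f y))\<^sup>2 / 2) * ennreal (normal_density x e y)) \<partial>lborel \<partial>lborel)"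
    by (rule nn_integral_cmult) measurable
  also have "(\<integral>\<^sup>+x. \<integral>\<^sup>+y. (ennreal ((cmod (f x))\<^sup>2 / 2) * ennreal (normal_density x e y)
      + ennreal ((cmod (f y))\<^sup>2 / 2) * ennreal (normal_density x e y)) \<partial>lborel \<partial>lborel)
    = (\<integral>\<^sup>+x. ennreal ((cmod (f x))\<^sup>2 / 2) \<partial>lborel) + (\<integral>\<^sup>+x. ennreal ((cmod (f x))\<^sup>2 / 2) \<partial>lborel)"
  proof -
    have "(\<integral>\<^sup>+x. \<integral>\<^sup>+y. (ennreal ((cmod (f x))\<^sup>2 / 2) * ennreal (normal_density x e y)
      + ennreal ((cmod (f y))\<^sup>2 / 2) * ennreal (normal_density x e y)) \<partial>lborel \<partial>lborel)
      = (\<integral>\<^sup>+x. (\<integral>\<^sup>+y. ennreal ((cmod (f x))\<^sup>2 / 2) * ennreal (normal_density x e y) \<partial>lborel)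
      + (\<integral>\<^sup>+y. ennreal ((cmod (f y))\<^sup>2 / 2) * ennreal (normal_density x e y) \<partial>lborel) \<partial>lborel)"
      by (intro nn_integral_cong nn_integral_add) auto
    also have "\<dots> = (\<integral>\<^sup>+x. (\<integral>\<^sup>+y. ennreal ((cmod (f x))\<^sup>2 / 2) * ennreal (normal_density x e y) \<partial>lborel) \<partial>lborel)
      + (\<integral>\<^sup>+x. (\<integral>\<^sup>+y. ennreal ((cmod (f y))\<^sup>2 / 2) * ennreal (normal_density x e y) \<partial>lborel) \<partial>lborel)"
      by (rule nn_integral_add) measurable
    also have "\<dots> = (\<integral>\<^sup>+x. ennreal ((cmod (f x))\<^sup>2 / 2) \<partial>lborel) + (\<integral>\<^sup>+x. ennreal ((cmod (f x))\<^sup>2 / 2) \<partial>lborel)"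
      by (intro arg_cong2[where f="(+)"] nn_integral_normal_density_mult e) measurable
    finally show ?thesis .
  qed
  also have "\<dots> = (\<integral>\<^sup>+x. ennreal ((cmod (f x))\<^sup>2) \<partial>lborel)"
    by (subst nn_integral_add[symmetric]) (auto simp: ennreal_plus[symmetric] simp del: ennreal_plus)
  finally show ?thesis .
qed

text \<open>The Gaussian weights tend to 1 pointwise as \<open>e\<close> tends to 0, and Fatou's
  lemma passes to the limit because the Gaussian bound does not depend on \<open>e\<close>.\<close>

lemma bessel:
  assumes f: "integrable lborel f"
  shows "(\<integral>\<^sup>+\<xi>. ennreal ((cmod (fint f \<xi>))\<^sup>2) \<partial>lborel)
    \<le> ennreal (2 * pi) * (\<integral>\<^sup>+x. ennreal ((cmod (f x))\<^sup>2) \<partial>lborel)"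
proof -
  note [measurable] = fint_measurable[OF f] borel_measurable_integrable[OF f]
  let ?u = "\<lambda>n \<xi>. ennreal ((cmod (fint f \<xi>))\<^sup>2 * exp (- (1 / real (Suc n) * \<xi>)\<^sup>2 / 2))"
  have "(\<lambda>n. ?u n \<xi>) \<longlonglongrightarrow> ennreal ((cmod (fint f \<xi>))\<^sup>2 * exp (- (0 * \<xi>)\<^sup>2 / 2))" for \<xi>
    by (intro tendsto_ennrealI tendsto_intros LIMSEQ_Suc lim_1_over_n) auto
  then have "(\<integral>\<^sup>+\<xi>. ennreal ((cmod (fint f \<xi>))\<^sup>2) \<partial>lborel) = (\<integral>\<^sup>+\<xi>. liminf (\<lambda>n. ?u n \<xi>) \<partial>lborel)"
    by (intro nn_integral_cong lim_imp_Liminf[symmetric]) auto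
  also have "\<dots> \<le> liminf (\<lambda>n. \<integral>\<^sup>+\<xi>. ?u n \<xi> \<partial>lborel)"
    by (rule nn_integral_liminf) auto
  also have "\<dots> \<le> liminf (\<lambda>n. ennreal (2 * pi) * (\<integral>\<^sup>+x. ennreal ((cmod (f x))\<^sup>2) \<partial>lborel))"
    by (intro Liminf_mono always_eventually allI bessel_gaussian f) auto
  finally show ?thesis by (simp add: Liminf_const)
qed

section \<open>The Fourier transform of a weak derivative\<close>

text \<open>The definitions integrate over the completed measure, the Fubini arguments over the
  Borel one; this passes from one to the other. Borel versions are taken of the real and imaginary
  parts separately.\<close>

lemma lebesgue_borel_version:
  fixes f :: "real \<Rightarrow> complex"
  assumes f: "f \<in> borel_measurable lebesgue"
  obtains f' where "f' \<in> borel_measurable borel" "AE x in lebesgue. f x = f' x"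
proof -
  have "\<exists>g\<in>borel_measurable lborel. AE x in lborel. Re (f x) = g x"
    using f by (intro completion_ex_borel_measurable_real) measurable
  moreover have "\<exists>g\<in>borel_measurable lborel. AE x in lborel. Im (f x) = g x"
    using f by (intro completion_ex_borel_measurable_real) measurable
  ultimately obtain u v where uv: "u \<in> borel_measurable borel" "v \<in> borel_measurable borel"
    "AE x in lborel. Re (f x) = u x" "AE x in lborel. Im (f x) = v x" by auto
  from uv(3,4) have "AE x in lborel. f x = Complex (u x) (v x)"
    by eventually_elim (auto simp: complex_eq_iff)
  moreover have "(\<lambda>x. Complex (u x) (v x)) = (\<lambda>x. of_real (u x) + \<i> * of_real (v x))"
    by (auto simp: complex_eq_iff)
  then have "(\<lambda>x. Complex (u x) (v x)) \<in> borel_measurable borel"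
    using uv(1,2) by simp
  ultimately show ?thesis using that AE_completion by blast
qed

lemma borel_imp_lebesgue_measurable:
  "h \<in> borel_measurable borel \<Longrightarrow> h \<in> borel_measurable lebesgue"
  by (simp add: measurable_completion)

lemma integral_lebesgue_borel_version:
  fixes u u' :: "real \<Rightarrow> 'b::{banach, second_countable_topology}"
  assumes "u \<in> borel_measurable lebesgue" "u' \<in> borel_measurable borel" "AE x in lebesgue. u x = u' x"
  shows "integral\<^sup>L lebesgue u = integral\<^sup>L lborel u'" 
    and "integrable lebesgue u \<longleftrightarrow> integrable lborel u'"
proof -
  have u': "u' \<in> borel_measurable lborel" "u' \<in> borel_measurable lebesgue"
    using assms(2) borel_imp_lebesgue_measurable by auto
  show "integral\<^sup>L lebesgue u = integral\<^sup>L lborel u'"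
    using integral_cong_AE[OF assms(1) u'(2) assms(3)] integral_completion[OF u'(1)] by simp
  show "integrable lebesgue u \<longleftrightarrow> integrable lborel u'"
    using integrable_cong_AE[OF assms(1) u'(2) assms(3)] integrable_completion[OF u'(1)] by simp
qed

lemma fourier_eq_fint:
  assumes [measurable]: "f \<in> borel_measurable lebesgue" "f' \<in> borel_measurable borel"
    and ae: "AE x in lebesgue. f x = f' x"
  shows "fourier f \<xi> = fint f' \<xi> / of_real (2 * pi)"
proof -
  have [measurable]: "(\<lambda>x. cis (- (x * \<xi>))) \<in> borel_measurable lebesgue"
    by (rule borel_imp_lebesgue_measurable) measurable
  have "(LINT x|lebesgue. cis (- (x * \<xi>)) * f x) = fint f' \<xi>"
    unfolding fint_def using ae by (intro integral_lebesgue_borel_version) auto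
  then show ?thesis by (simp add: fourier_def)
qed

text \<open>A cutoff makes an L^2 function integrable: |g| \<le> 1 + |g|^2, and the constant 1 is
  integrable on \<open>{-R..R}\<close>.\<close>

lemma integrable_L2_cutoff:
  fixes g :: "real \<Rightarrow> complex"
  assumes [measurable]: "g \<in> borel_measurable borel" "h \<in> borel_measurable borel"
    and g: "integrable lborel (\<lambda>x. (cmod (g x))\<^sup>2)"
    and h: "\<And>x. \<bar>h x\<bar> \<le> 1" "\<And>x. \<bar>x\<bar> > R \<Longrightarrow> h x = 0"
  shows "integrable lborel (\<lambda>x. h x *\<^sub>R g x)"
proof (rule Bochner_Integration.integrable_bound)
  show "integrable lborel (\<lambda>x. indicator {-R..R} x + (cmod (g x))\<^sup>2)"
    by (intro Bochner_Integration.integrable_add g integrable_real_indicator) (auto simp: emeasure_lborel_Icc_eq)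
  show "AE x in lborel. norm (h x *\<^sub>R g x) \<le> norm (indicator {-R..R} x + (cmod (g x))\<^sup>2)"
  proof (rule AE_I2)
    fix x
    have "cmod (g x) \<le> 1 + (cmod (g x))\<^sup>2"
      using sum_squares_bound[of 1 "cmod (g x)"] norm_ge_zero[of "g x"] unfolding power_one mult_1_right by linarith
    moreover have "\<bar>h x\<bar> * cmod (g x) \<le> 1 * cmod (g x)" by (intro mult_right_mono h) auto
    ultimately show "norm (h x *\<^sub>R g x) \<le> norm (indicator {-R..R} x + (cmod (g x))\<^sup>2)"
      using h(2)[of x] by (cases "\<bar>x\<bar> \<le> R") (auto simp: indicator_def)
  qed
qed measurable

section \<open>Testing the weak derivative against truncated exponentials\<close>

lemma smooth_measurable: "smooth f \<Longrightarrow> f \<in> borel_measurable borel"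
  by (intro borel_measurable_continuous_onI smooth_continuous)

lemma test_function_iff: "test_function \<phi> \<longleftrightarrow> smooth \<phi> \<and> bounded {x. \<phi> x \<noteq> 0}"
  by (simp add: test_function_def smooth_def)

text \<open>This is integration by parts against \<open>h x * cis (- (x * \<xi>))\<close>, with one
  term from the exponential and one from the cutoff. Test functions are real-valued, so it is
  carried out for \<open>h\<close> times cosine and \<open>h\<close> times sine and then
  recombined.\<close>

lemma fint_cutoff_weak_deriv:
  assumes f: "integrable lborel f" and gm[measurable]: "g \<in> borel_measurable borel"
    and g: "integrable lborel (\<lambda>x. (cmod (g x))\<^sup>2)"
    and wd: "\<And>\<phi>. test_function \<phi> \<Longrightarrow>
      (LINT x|lborel. deriv \<phi> x *\<^sub>R f x) = - (LINT x|lborel. \<phi> x *\<^sub>R g x)"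
    and h: "smooth h" "\<And>x. \<bar>h x\<bar> \<le> 1" "\<And>x. \<bar>x\<bar> > R \<Longrightarrow> h x = 0" "\<And>x. \<bar>deriv h x\<bar> \<le> M"
  shows "fint (\<lambda>x. h x *\<^sub>R g x) \<xi> = \<i> * of_real \<xi> * fint (\<lambda>x. h x *\<^sub>R f x) \<xi> - fint (\<lambda>x. deriv h x *\<^sub>R f x) \<xi>"
proof -
  note [measurable] = borel_measurable_integrable[OF f]
  have [measurable]: "h \<in> borel_measurable borel" "deriv h \<in> borel_measurable borel"
    by (rule smooth_measurable[OF h(1)], rule smooth_measurable[OF smooth_deriv[OF h(1)]])
  have sc: "smooth (\<lambda>x. cos (\<xi> * x))" "smooth (\<lambda>x. sin (\<xi> * x))"
    using smooth_affine[OF smooth_cos, of \<xi> 0] smooth_affine[OF smooth_sin, of \<xi> 0] by auto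
  let ?c = "\<lambda>x. h x * cos (\<xi> * x)" and ?s = "\<lambda>x. h x * sin (\<xi> * x)"
  have b: "bounded {x. h x \<noteq> 0}"
    by (rule bounded_subset[OF bounded_closed_interval[of "-R" R]]) (use h(3) in force)
  have tc: "test_function ?c" and ts: "test_function ?s"
    using h(1) sc smooth_mult by (auto simp: test_function_iff intro: bounded_subset[OF b])
  have Dh: "DERIV h x :> deriv h x" for x using h(1) smooth_DERIV by auto
  have dc: "deriv ?c x = deriv h x * cos (\<xi> * x) - \<xi> * (h x * sin (\<xi> * x))" for x
    by (rule DERIV_imp_deriv) (auto intro!: derivative_eq_intros Dh)
  have ds: "deriv ?s x = deriv h x * sin (\<xi> * x) + \<xi> * (h x * cos (\<xi> * x))" for x
    by (rule DERIV_imp_deriv) (auto intro!: derivative_eq_intros Dh)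
  have ig: "integrable lborel (\<lambda>x. (h x * k x) *\<^sub>R g x)" if [measurable]: "k \<in> borel_measurable borel" and "\<And>x. \<bar>k x\<bar> \<le> 1" for k
    using that h mult_mono[OF h(2) that(2)] by (intro integrable_L2_cutoff[OF _ _ g, of _ R]) (auto simp: abs_mult)
  have if1: "integrable lborel (\<lambda>x. (h x * k x) *\<^sub>R f x)" if [measurable]: "k \<in> borel_measurable borel" and k: "\<And>x. \<bar>k x\<bar> \<le> 1" for k
  proof (rule Bochner_Integration.integrable_bound[OF f])
    have "\<bar>h x * k x\<bar> * cmod (f x) \<le> 1 * cmod (f x)" for x
      using mult_mono[OF h(2) k, of x x] by (intro mult_right_mono) (auto simp: abs_mult)
    then show "AE x in lborel. norm ((h x * k x) *\<^sub>R f x) \<le> norm (f x)" by auto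
  qed measurable
  have if2: "integrable lborel (\<lambda>x. (deriv h x * k x) *\<^sub>R f x)" if [measurable]: "k \<in> borel_measurable borel" and k: "\<And>x. \<bar>k x\<bar> \<le> 1" for k
  proof (rule Bochner_Integration.integrable_bound)
    show "integrable lborel (\<lambda>x. M *\<^sub>R f x)" using f by auto
    have "\<bar>deriv h x * k x\<bar> * cmod (f x) \<le> \<bar>M\<bar> * cmod (f x)" for x
      using mult_mono[OF h(4) k, of x x] h(4)[of x] by (intro mult_right_mono) (auto simp: abs_mult)
    then show "AE x in lborel. norm ((deriv h x * k x) *\<^sub>R f x) \<le> norm (M *\<^sub>R f x)" by auto
  qed measurable
  have E: "cis (- (x * \<xi>)) * (a *\<^sub>R z) = (a * cos (\<xi> * x)) *\<^sub>R z - \<i> * ((a * sin (\<xi> * x)) *\<^sub>R z)" for x a z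
    by (simp add: complex_eq_iff algebra_simps)
  have L: "(LINT x|lborel. a x - \<i> * b x) = (LINT x|lborel. a x) - \<i> * (LINT x|lborel. b x)"
    if "integrable lborel a" "integrable lborel b" for a b :: "real \<Rightarrow> complex"
    using that by simp
  have e1: "fint (\<lambda>x. h x *\<^sub>R g x) \<xi> = (LINT x|lborel. ?c x *\<^sub>R g x) - \<i> * (LINT x|lborel. ?s x *\<^sub>R g x)"
    unfolding fint_def E by (intro L ig) auto
  have e2: "fint (\<lambda>x. h x *\<^sub>R f x) \<xi> = (LINT x|lborel. ?c x *\<^sub>R f x) - \<i> * (LINT x|lborel. ?s x *\<^sub>R f x)"
    unfolding fint_def E by (intro L if1) auto
  have e3: "fint (\<lambda>x. deriv h x *\<^sub>R f x) \<xi> = (LINT x|lborel. (deriv h x * cos (\<xi> * x)) *\<^sub>R f x) - \<i> * (LINT x|lborel. (deriv h x * sin (\<xi> * x)) *\<^sub>R f x)"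
    unfolding fint_def E by (intro L if2) auto
  have e4: "(LINT x|lborel. ?c x *\<^sub>R g x) = - ((LINT x|lborel. (deriv h x * cos (\<xi> * x)) *\<^sub>R f x) - \<xi> *\<^sub>R (LINT x|lborel. ?s x *\<^sub>R f x))"
  proof -
    have "(LINT x|lborel. deriv ?c x *\<^sub>R f x) = (LINT x|lborel. (deriv h x * cos (\<xi> * x)) *\<^sub>R f x - \<xi> *\<^sub>R (?s x *\<^sub>R f x))"
      unfolding dc by (intro Bochner_Integration.integral_cong) (auto simp: algebra_simps)
    also have "\<dots> = (LINT x|lborel. (deriv h x * cos (\<xi> * x)) *\<^sub>R f x) - (LINT x|lborel. \<xi> *\<^sub>R (?s x *\<^sub>R f x))"
      by (intro Bochner_Integration.integral_diff if2 integrable_scaleR_right if1) auto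
    also have "(LINT x|lborel. \<xi> *\<^sub>R (?s x *\<^sub>R f x)) = \<xi> *\<^sub>R (LINT x|lborel. ?s x *\<^sub>R f x)"
      by (rule integral_scaleR_right)
    finally show ?thesis unfolding wd[OF tc] by (metis minus_minus)
  qed
  have e5: "(LINT x|lborel. ?s x *\<^sub>R g x) = - ((LINT x|lborel. (deriv h x * sin (\<xi> * x)) *\<^sub>R f x) + \<xi> *\<^sub>R (LINT x|lborel. ?c x *\<^sub>R f x))"
  proof -
    have "(LINT x|lborel. deriv ?s x *\<^sub>R f x) = (LINT x|lborel. (deriv h x * sin (\<xi> * x)) *\<^sub>R f x + \<xi> *\<^sub>R (?c x *\<^sub>R f x))"
      unfolding ds by (intro Bochner_Integration.integral_cong) (auto simp: algebra_simps)
    also have "\<dots> = (LINT x|lborel. (deriv h x * sin (\<xi> * x)) *\<^sub>R f x) + (LINT x|lborel. \<xi> *\<^sub>R (?c x *\<^sub>R f x))"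
      by (intro Bochner_Integration.integral_add if2 integrable_scaleR_right if1) auto
    also have "(LINT x|lborel. \<xi> *\<^sub>R (?c x *\<^sub>R f x)) = \<xi> *\<^sub>R (LINT x|lborel. ?c x *\<^sub>R f x)"
      by (rule integral_scaleR_right)
    finally show ?thesis unfolding wd[OF ts] by (metis minus_minus)
  qed
  show ?thesis
    unfolding e1 e2 e3 e4 e5 by (simp add: complex_eq_iff algebra_simps)
qed

text \<open>Bessel's inequality asks for an integrable function while \<open>g\<close> is only
  square integrable, so it is applied to \<open>g\<close> times cutoffs \<open>h n\<close>. By the
  cutoff identity the transforms converge pointwise to
  \<open>\<i> * of_real \<xi> * fint f \<xi>\<close>, and Fatou's lemma concludes.\<close>

lemma fint_weak_deriv_L2:
  assumes f: "integrable lborel f" and gm[measurable]: "g \<in> borel_measurable borel"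
    and g: "integrable lborel (\<lambda>x. (cmod (g x))\<^sup>2)"
    and wd: "\<And>\<phi>. test_function \<phi> \<Longrightarrow>
      (LINT x|lborel. deriv \<phi> x *\<^sub>R f x) = - (LINT x|lborel. \<phi> x *\<^sub>R g x)"
  shows "(\<integral>\<^sup>+\<xi>. ennreal ((\<xi> * cmod (fint f \<xi>))\<^sup>2) \<partial>lborel)
    \<le> ennreal (2 * pi) * (\<integral>\<^sup>+x. ennreal ((cmod (g x))\<^sup>2) \<partial>lborel)"
proof -
  note [measurable] = borel_measurable_integrable[OF f] fint_measurable[OF f]
  obtain \<eta> :: "real \<Rightarrow> real" where \<eta>: "smooth \<eta>" "\<eta> 0 = 1" "\<And>x. 0 \<le> \<eta> x" "\<And>x. \<eta> x \<le> 1"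
    "\<And>x. \<bar>x\<bar> \<ge> 1 \<Longrightarrow> \<eta> x = 0" using smooth_bump_exists by metis
  have [measurable]: "\<eta> \<in> borel_measurable borel" by (rule smooth_measurable[OF \<eta>(1)])
  have "compact (deriv \<eta> ` {-1..1})"
    by (rule compact_continuous_image[OF continuous_on_subset[OF smooth_continuous[OF smooth_deriv[OF \<eta>(1)]]]]) auto
  then obtain M0 where M0: "\<And>x. x \<in> {-1..1} \<Longrightarrow> \<bar>deriv \<eta> x\<bar> \<le> M0"
    by (fastforce dest!: compact_imp_bounded simp: bounded_iff)
  \<comment> \<open>The maximum with 0 makes \<open>M\<close> visibly bound the zero derivative
    outside [-1, 1] too.\<close>
  define M where "M = max M0 0"
  have M: "\<bar>deriv \<eta> x\<bar> \<le> M" for x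
  proof (cases "\<bar>x\<bar> \<le> 1")
    case True then show ?thesis using M0[of x] by (auto simp: M_def abs_le_iff)
  next
    case False
    have "eventually (\<lambda>y. \<eta> y = 0) (nhds x)"
    proof (rule eventually_mono[OF eventually_nhds_in_open[of "{y. 1 < \<bar>y\<bar>}" x]])
      show "open {y::real. 1 < \<bar>y\<bar>}" by (intro open_Collect_less continuous_intros)
    qed (use False \<eta>(5) in auto)
    then have "DERIV \<eta> x :> 0" by (subst DERIV_cong_ev[OF refl _ refl]) auto
    then show ?thesis by (simp add: DERIV_imp_deriv M_def)
  qed
  \<comment> \<open>The dilated cutoffs tend to 1 pointwise while their slopes are O(1/n), which
    removes the term with \<open>deriv (h n)\<close> in the limit.\<close>
  define h where "h n x = \<eta> (1 / real (Suc n) * x + 0)" for n x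
  have hs: "smooth (h n)" for n unfolding h_def by (rule smooth_affine[OF \<eta>(1)])
  have [measurable]: "h n \<in> borel_measurable borel" "deriv (h n) \<in> borel_measurable borel" for n
    by (rule smooth_measurable[OF hs], rule smooth_measurable[OF smooth_deriv[OF hs]])
  have h1: "\<bar>h n x\<bar> \<le> 1" for n x using \<eta>(3,4) by (simp add: h_def)
  have h0: "h n x = 0" if "\<bar>x\<bar> > real (Suc n)" for n x
    unfolding h_def using that by (intro \<eta>(5)) (simp add: abs_mult)
  have hd: "\<bar>deriv (h n) x\<bar> \<le> M / real (Suc n)" for n x
  proof -
    have "DERIV (h n) x :> deriv \<eta> (1 / real (Suc n) * x + 0) * (1 / real (Suc n))"
      unfolding h_def by (rule DERIV_chain2[OF smooth_DERIV[OF \<eta>(1)]]) (auto intro!: derivative_eq_intros)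
    then have "deriv (h n) x = deriv \<eta> (1 / real (Suc n) * x + 0) * (1 / real (Suc n))"
      by (rule DERIV_imp_deriv)
    then show ?thesis using M[of "1 / real (Suc n) * x + 0"] by (simp add: divide_right_mono)
  qed
  have l0: "(\<lambda>n. 1 / real (Suc n)) \<longlonglongrightarrow> 0" by (rule LIMSEQ_Suc[OF lim_1_over_n])
  have igh: "integrable lborel (\<lambda>x. h n x *\<^sub>R g x)" for n
    by (rule integrable_L2_cutoff[OF _ _ g h1 h0]) auto
  have lim: "(\<lambda>n. fint (\<lambda>x. h n x *\<^sub>R g x) \<xi>) \<longlonglongrightarrow> \<i> * of_real \<xi> * fint f \<xi> - 0" for \<xi>
  proof -
    have "(\<lambda>n. fint (\<lambda>x. h n x *\<^sub>R f x) \<xi>) \<longlonglongrightarrow> fint f \<xi>"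
      unfolding fint_def
    proof (rule integral_dominated_convergence[where w="\<lambda>x. cmod (f x)"])
      show "AE x in lborel. (\<lambda>n. cis (- (x * \<xi>)) * h n x *\<^sub>R f x) \<longlonglongrightarrow> cis (- (x * \<xi>)) * f x"
      proof (rule AE_I2)
        fix x
        have "isCont \<eta> 0" using smooth_DERIV[OF \<eta>(1)] DERIV_isCont by blast
        moreover have "(\<lambda>n. 1 / real (Suc n) * x + 0) \<longlonglongrightarrow> 0 * x + 0"
          by (intro tendsto_add tendsto_mult tendsto_const l0)
        ultimately have "(\<lambda>n. h n x) \<longlonglongrightarrow> 1"
          unfolding h_def using isCont_tendsto_compose[of 0 \<eta>] \<eta>(2) by auto
        then have "(\<lambda>n. cis (- (x * \<xi>)) * h n x *\<^sub>R f x) \<longlonglongrightarrow> cis (- (x * \<xi>)) * (1 *\<^sub>R f x)"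
          by (intro tendsto_diff tendsto_mult tendsto_scaleR tendsto_const)
        then show "(\<lambda>n. cis (- (x * \<xi>)) * h n x *\<^sub>R f x) \<longlonglongrightarrow> cis (- (x * \<xi>)) * f x" by simp
      qed
      show "AE x in lborel. norm (cis (- (x * \<xi>)) * h n x *\<^sub>R f x) \<le> cmod (f x)" for n
        using h1 by (auto simp: norm_mult intro!: mult_left_le_one_le)
    qed (use f in auto)
    moreover have "(\<lambda>n. fint (\<lambda>x. deriv (h n) x *\<^sub>R f x) \<xi>) \<longlonglongrightarrow> 0"
    proof (rule Lim_null_comparison)
      show "(\<lambda>n. M * (1 / real (Suc n)) * (LINT x|lborel. cmod (f x))) \<longlonglongrightarrow> 0"
        using tendsto_mult[OF tendsto_mult[OF tendsto_const[of M] l0] tendsto_const[of "LINT x|lborel. cmod (f x)"]] by simp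
      have "cmod (fint (\<lambda>x. deriv (h n) x *\<^sub>R f x) \<xi>) \<le> M * (1 / real (Suc n)) * (LINT x|lborel. cmod (f x))" for n
      proof -
        have "(LINT x|lborel. cmod (deriv (h n) x *\<^sub>R f x)) \<le> (LINT x|lborel. M / real (Suc n) * cmod (f x))"
        proof (rule integral_mono)
          show "integrable lborel (\<lambda>x. M / real (Suc n) * cmod (f x))" using f by auto
          have le: "cmod (deriv (h n) x *\<^sub>R f x) \<le> M / real (Suc n) * cmod (f x)" for x
            using mult_right_mono[OF hd norm_ge_zero] by simp
          show "integrable lborel (\<lambda>x. cmod (deriv (h n) x *\<^sub>R f x))"
          proof (rule Bochner_Integration.integrable_bound)
            show "integrable lborel (\<lambda>x. M / real (Suc n) * cmod (f x))" using f by auto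
            show "AE x in lborel. norm (cmod (deriv (h n) x *\<^sub>R f x)) \<le> norm (M / real (Suc n) * cmod (f x))"
              using order.trans[OF le abs_ge_self] by (intro AE_I2) (simp only: real_norm_def abs_norm_cancel)
          qed measurable
          show "cmod (deriv (h n) x *\<^sub>R f x) \<le> M / real (Suc n) * cmod (f x)" for x by (rule le)
        qed
        then show ?thesis using cmod_fint_le[of "\<lambda>x. deriv (h n) x *\<^sub>R f x" \<xi>] by simp
      qed
      then show "\<forall>\<^sub>F n in sequentially. cmod (fint (\<lambda>x. deriv (h n) x *\<^sub>R f x) \<xi>) \<le> M * (1 / real (Suc n)) * (LINT x|lborel. cmod (f x))"
        by auto
    qed
    ultimately have "(\<lambda>n. \<i> * of_real \<xi> * fint (\<lambda>x. h n x *\<^sub>R f x) \<xi> - fint (\<lambda>x. deriv (h n) x *\<^sub>R f x) \<xi>)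
      \<longlonglongrightarrow> \<i> * of_real \<xi> * fint f \<xi> - 0"
      by (intro tendsto_diff tendsto_mult tendsto_scaleR tendsto_const)
    moreover have "fint (\<lambda>x. h n x *\<^sub>R g x) \<xi> = \<i> * of_real \<xi> * fint (\<lambda>x. h n x *\<^sub>R f x) \<xi> - fint (\<lambda>x. deriv (h n) x *\<^sub>R f x) \<xi>" for n
      by (rule fint_cutoff_weak_deriv[OF f gm g wd hs h1 h0 hd])
    ultimately show ?thesis by simp
  qed
  let ?u = "\<lambda>n \<xi>. ennreal ((cmod (fint (\<lambda>x. h n x *\<^sub>R g x) \<xi>))\<^sup>2)"
  have [measurable]: "fint (\<lambda>x. h n x *\<^sub>R g x) \<in> borel_measurable borel" for n
    by (rule fint_measurable[OF igh])
  have "(\<lambda>n. ?u n \<xi>) \<longlonglongrightarrow> ennreal ((cmod (\<i> * of_real \<xi> * fint f \<xi> - 0))\<^sup>2)" for \<xi>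
    by (intro tendsto_ennrealI tendsto_power tendsto_norm lim)
  then have "(\<integral>\<^sup>+\<xi>. ennreal ((\<xi> * cmod (fint f \<xi>))\<^sup>2) \<partial>lborel) = (\<integral>\<^sup>+\<xi>. liminf (\<lambda>n. ?u n \<xi>) \<partial>lborel)"
    by (intro nn_integral_cong lim_imp_Liminf[symmetric]) (auto simp: norm_mult power_mult_distrib)
  also have "\<dots> \<le> liminf (\<lambda>n. \<integral>\<^sup>+\<xi>. ?u n \<xi> \<partial>lborel)"
    by (rule nn_integral_liminf) auto
  also have "\<dots> \<le> liminf (\<lambda>n. ennreal (2 * pi) * (\<integral>\<^sup>+x. ennreal ((cmod (g x))\<^sup>2) \<partial>lborel))"
  proof (intro Liminf_mono always_eventually allI)
    fix n
    have "(\<integral>\<^sup>+\<xi>. ?u n \<xi> \<partial>lborel) \<le> ennreal (2 * pi) * (\<integral>\<^sup>+x. ennreal ((cmod (h n x *\<^sub>R g x))\<^sup>2) \<partial>lborel)"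
      by (rule bessel[OF igh])
    also have "\<dots> \<le> ennreal (2 * pi) * (\<integral>\<^sup>+x. ennreal ((cmod (g x))\<^sup>2) \<partial>lborel)"
      using h1 by (intro mult_left_mono nn_integral_mono ennreal_leI power_mono) (auto intro: mult_left_le_one_le)
    finally show "(\<integral>\<^sup>+\<xi>. ?u n \<xi> \<partial>lborel) \<le> \<dots>" .
  qed
  finally show ?thesis by (simp add: Liminf_const)
qed

text \<open>The hypotheses are moved to Borel versions of \<open>f\<close> and \<open>g\<close>. The
  constant is the 2 pi of Bessel's inequality over the (2 pi)^2 from the normalisation of
  \<open>fourier\<close>.\<close>

lemma fourier_weak_deriv_L2:
  assumes f: "integrable lebesgue f" and wd: "has_L2_weak_deriv f g"
  shows "integrable lborel (\<lambda>\<xi>. (\<xi> * cmod (fourier f \<xi>))\<^sup>2)"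
    and "(LINT \<xi>|lborel. (\<xi> * cmod (fourier f \<xi>))\<^sup>2) \<le> (LINT x|lebesgue. (cmod (g x))\<^sup>2) / (2 * pi)"
proof -
  have fm[measurable]: "f \<in> borel_measurable lebesgue" using f by auto
  have gm[measurable]: "g \<in> borel_measurable lebesgue" and gi: "integrable lebesgue (\<lambda>x. (cmod (g x))\<^sup>2)"
    using wd by (auto simp: has_L2_weak_deriv_def in_L2_def)
  obtain f' where f'[measurable]: "f' \<in> borel_measurable borel" and aef: "AE x in lebesgue. f x = f' x"
    using lebesgue_borel_version[OF fm] .
  obtain g' where g'[measurable]: "g' \<in> borel_measurable borel" and aeg: "AE x in lebesgue. g x = g' x"
    using lebesgue_borel_version[OF gm] .
  have fi: "integrable lborel f'" using integral_lebesgue_borel_version(2)[OF fm f' aef] f by simp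
  note [measurable] = fint_measurable[OF fi]
  have sq: "(\<lambda>x. (cmod (g' x))\<^sup>2) \<in> borel_measurable borel" "AE x in lebesgue. (cmod (g x))\<^sup>2 = (cmod (g' x))\<^sup>2"
    using aeg by auto
  have sqm: "(\<lambda>x. (cmod (g x))\<^sup>2) \<in> borel_measurable lebesgue" by measurable
  have g'i: "integrable lborel (\<lambda>x. (cmod (g' x))\<^sup>2)"
    using integral_lebesgue_borel_version(2)[OF sqm sq] gi by simp
  have wd': "(LINT x|lborel. deriv \<phi> x *\<^sub>R f' x) = - (LINT x|lborel. \<phi> x *\<^sub>R g' x)" if t: "test_function \<phi>" for \<phi>
  proof -
    have m[measurable]: "\<phi> \<in> borel_measurable borel" "deriv \<phi> \<in> borel_measurable borel"
      using t smooth_deriv smooth_measurable by (auto simp: test_function_iff)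
    note [measurable] = borel_imp_lebesgue_measurable[OF m(1)] borel_imp_lebesgue_measurable[OF m(2)]
    have "(LINT x|lebesgue. deriv \<phi> x *\<^sub>R f x) = (LINT x|lborel. deriv \<phi> x *\<^sub>R f' x)"
      using aef by (intro integral_lebesgue_borel_version(1)) auto
    moreover have "(LINT x|lebesgue. \<phi> x *\<^sub>R g x) = (LINT x|lborel. \<phi> x *\<^sub>R g' x)"
      using aeg by (intro integral_lebesgue_borel_version(1)) auto
    ultimately show ?thesis using wd t by (simp add: has_L2_weak_deriv_def)
  qed
  let ?K = "LINT x|lborel. (cmod (g' x))\<^sup>2"
  have "(\<integral>\<^sup>+\<xi>. ennreal ((\<xi> * cmod (fint f' \<xi>))\<^sup>2) \<partial>lborel)
    \<le> ennreal (2 * pi) * (\<integral>\<^sup>+x. ennreal ((cmod (g' x))\<^sup>2) \<partial>lborel)"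
    by (rule fint_weak_deriv_L2[OF fi g' g'i wd'])
  also have "\<dots> = ennreal (2 * pi * ?K)"
    by (subst nn_integral_eq_integral[OF g'i]) (auto simp: ennreal_mult)
  finally have le: "(\<integral>\<^sup>+\<xi>. ennreal ((\<xi> * cmod (fint f' \<xi>))\<^sup>2) \<partial>lborel) \<le> ennreal (2 * pi * ?K)" .
  have int: "integrable lborel (\<lambda>\<xi>. (\<xi> * cmod (fint f' \<xi>))\<^sup>2)"
    by (rule integrableI_bounded) (use le in \<open>auto intro: le_less_trans\<close>)
  have le': "(LINT \<xi>|lborel. (\<xi> * cmod (fint f' \<xi>))\<^sup>2) \<le> 2 * pi * ?K"
    using le by (subst (asm) nn_integral_eq_integral[OF int]) auto
  have eq: "(\<xi> * cmod (fourier f \<xi>))\<^sup>2 = (\<xi> * cmod (fint f' \<xi>))\<^sup>2 / (2 * pi)\<^sup>2" for \<xi>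
    unfolding fourier_eq_fint[OF fm f' aef] by (simp add: norm_divide norm_mult power_divide power_mult_distrib)
  show "integrable lborel (\<lambda>\<xi>. (\<xi> * cmod (fourier f \<xi>))\<^sup>2)" unfolding eq using int by simp
  have "(LINT x|lebesgue. (cmod (g x))\<^sup>2) = ?K" by (rule integral_lebesgue_borel_version(1)[OF sqm sq])
  then show "(LINT \<xi>|lborel. (\<xi> * cmod (fourier f \<xi>))\<^sup>2) \<le> (LINT x|lebesgue. (cmod (g x))\<^sup>2) / (2 * pi)"
    unfolding eq using le' by (simp add: field_simps power2_eq_square)
qed

section \<open>The dispersion relation\<close>

lemma omega_minus: "omega (- x) = omega x"
  by (simp add: omega_def)

lemma omega_abs: "omega \<bar>x\<bar> = omega x"
  by (simp add: abs_if omega_minus)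

text \<open>From tanh x = 1 - 2 / (exp (2 x) + 1) and exp (2 x) >= 1 + 2 x.\<close>

lemma tanh_ge: "x \<ge> 0 \<Longrightarrow> tanh x \<ge> x / (1 + x)" for x :: real
proof -
  assume x: "x \<ge> 0"
  have e: "exp (2 * x) \<ge> 1 + 2 * x" by simp
  have "tanh x = 1 - 2 / (exp (2 * x) + 1)"
  proof -
    have "tanh x = (exp x ^ 2 - 1) / (exp x ^ 2 + 1)"
      by (simp add: tanh_altdef exp_minus divide_simps power2_eq_square)
    also have "\<dots> = 1 - 2 / (exp x ^ 2 + 1)"
    proof -
      have "(exp x)\<^sup>2 + 1 > 0" by (simp add: add_pos_pos)
      then show ?thesis by (simp add: field_simps)
    qed
    finally show ?thesis by (simp add: exp_double)
  qed
  also have "\<dots> \<ge> 1 - 2 / (1 + 2 * x + 1)"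
    by (intro diff_left_mono divide_left_mono mult_pos_pos) (use e x in linarith)+
  also have "1 - 2 / (1 + 2 * x + 1) = x / (1 + x)" using x by (simp add: field_simps)
  finally show ?thesis .
qed

text \<open>The derivative of x - tanh x is tanh^2 x, and on [0, 1] tanh y >= y / (1 + y) >= y / 2;
  so it dominates y^2 / 4, the derivative of y^3 / 12.\<close>

lemma diff_tanh_ge_cube: "x - tanh x \<ge> x ^ 3 / 12" if "0 \<le> x" "x \<le> 1" for x :: real
proof -
  have "(\<lambda>x. x - tanh x - x^3/12) 0 \<le> (\<lambda>x. x - tanh x - x^3/12) x"
  proof (rule DERIV_nonneg_imp_nondecreasing[OF that(1)])
    fix y assume y: "0 \<le> y" "y \<le> x"
    have "y / 2 \<le> y / (1 + y)" using y that by (intro divide_left_mono) auto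
    also have "\<dots> \<le> tanh y" using tanh_ge y by auto
    finally have "(y / 2)\<^sup>2 \<le> (tanh y)\<^sup>2" using y by (intro power_mono) auto
    moreover have "DERIV (\<lambda>x. x - tanh x - x^3/12) y :> 1 - (1 - (tanh y)\<^sup>2) - 3 * y\<^sup>2 / 12"
      by (auto intro!: derivative_eq_intros simp: power2_eq_square)
    ultimately show "\<exists>d. DERIV (\<lambda>x. x - tanh x - x^3/12) y :> d \<and> d \<ge> 0"
      by (intro exI conjI) (auto simp: power_divide)
  qed
  then show ?thesis by simp
qed

text \<open>Beyond 1 the derivative tanh^2 is at least 1/4, above the slope 1/12; the cubic bound at
  1 supplies the starting value.\<close>

lemma diff_tanh_ge: "x - tanh x \<ge> x / 12" if "1 \<le> x" for x :: real
proof -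
  have "(\<lambda>x. x - tanh x - x/12) 1 \<le> (\<lambda>x. x - tanh x - x/12) x"
  proof (rule DERIV_nonneg_imp_nondecreasing[OF that(1)])
    fix y assume y: "1 \<le> y" "y \<le> x"
    have "1 / 2 \<le> y / (1 + y)" using y that by (simp add: field_simps)
    also have "\<dots> \<le> tanh y" using tanh_ge y by auto
    finally have "(1 / 2)\<^sup>2 \<le> (tanh y)\<^sup>2" using y by (intro power_mono) auto
    moreover have "DERIV (\<lambda>x. x - tanh x - x/12) y :> 1 - (1 - (tanh y)\<^sup>2) - 1 / 12"
      by (auto intro!: derivative_eq_intros simp: power2_eq_square)
    ultimately show "\<exists>d. DERIV (\<lambda>x. x - tanh x - x/12) y :> d \<and> d \<ge> 0"
      by (intro exI conjI) (auto simp: power_divide)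
  qed
  then show ?thesis using diff_tanh_ge_cube[of 1] by simp
qed

lemma omega_nonneg: "0 \<le> omega x"
  by (cases "x \<ge> 0") (auto simp: omega_def zero_le_divide_iff)

lemma omega_sq: "x \<noteq> 0 \<Longrightarrow> (omega x)\<^sup>2 = tanh x / x"
  by (cases "x \<ge> 0") (auto simp: omega_def zero_le_divide_iff)

text \<open>1 - omega^2 = (1 - omega) (1 + omega) is at most 2 (1 - omega), and omega^2 is tanh x /
  x.\<close>

lemma omega_gap:
  assumes "x > 0" shows "1 - omega x \<ge> (x - tanh x) / x / 2" and "omega x \<le> 1"
proof -
  have "tanh x \<le> x" using diff_tanh_ge_cube[of x] diff_tanh_ge[of x] assms
    zero_le_power[of x 3] by linarith
  then have 1: "(omega x)\<^sup>2 \<le> 1" using assms by (simp add: omega_sq)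
  then show le1: "omega x \<le> 1" using omega_nonneg[of x] by (simp add: abs_square_le_1)
  have "(1 - omega x) * 2 \<ge> (1 - omega x) * (1 + omega x)"
    using le1 omega_nonneg[of x] by (intro mult_left_mono) auto
  then have "(1 - omega x) * 2 \<ge> 1 - (omega x)\<^sup>2" by (simp add: algebra_simps power2_eq_square)
  then show "1 - omega x \<ge> (x - tanh x) / x / 2" using assms by (simp add: omega_sq field_simps)
qed

lemma omega_le_1: "omega x \<le> 1"
proof (cases "x = 0")
  case False
  then have "omega \<bar>x\<bar> \<le> 1" by (intro omega_gap(2)) auto
  then show ?thesis by (simp only: omega_abs)
qed (simp add: omega_def)

text \<open>The 24 is the 12 of \<open>diff_tanh_ge_cube\<close> times the 2 of
  \<open>omega_gap\<close>. This quadratic gap makes the low-frequency phase at least cubic in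
  size.\<close>

lemma omega_gap_small: "1 - omega x \<ge> x\<^sup>2 / 24" if "\<bar>x\<bar> \<le> 1"
proof (cases "x = 0")
  case False
  have "\<bar>x\<bar> ^ 3 / 12 / \<bar>x\<bar> / 2 \<le> (\<bar>x\<bar> - tanh \<bar>x\<bar>) / \<bar>x\<bar> / 2"
    using diff_tanh_ge_cube[of "\<bar>x\<bar>"] that by (intro divide_right_mono) auto
  also have "\<dots> \<le> 1 - omega \<bar>x\<bar>" using omega_gap[of "\<bar>x\<bar>"] False by auto
  finally show ?thesis using False by (simp add: omega_abs field_simps power2_eq_square power3_eq_cube)
qed (auto simp: omega_def)

text \<open>At high frequency the speed stays away from 1, so the phase grows at least
  linearly.\<close>

lemma omega_gap_large: "1 - omega x \<ge> 1 / 24" if "\<bar>x\<bar> \<ge> 1"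
proof -
  have "\<bar>x\<bar> / 12 / \<bar>x\<bar> / 2 \<le> (\<bar>x\<bar> - tanh \<bar>x\<bar>) / \<bar>x\<bar> / 2"
    using diff_tanh_ge[of "\<bar>x\<bar>"] that by (intro divide_right_mono) auto
  also have "\<dots> \<le> 1 - omega \<bar>x\<bar>" using omega_gap[of "\<bar>x\<bar>"] that by auto
  finally show ?thesis using that by (simp add: omega_abs field_simps)
qed

lemma omega_sq_le: "x \<noteq> 0 \<Longrightarrow> (omega x)\<^sup>2 \<le> 1 / \<bar>x\<bar>"
proof -
  assume x: "x \<noteq> 0"
  have "(omega \<bar>x\<bar>)\<^sup>2 = tanh \<bar>x\<bar> / \<bar>x\<bar>" using x by (intro omega_sq) auto
  also have "\<dots> \<le> 1 / \<bar>x\<bar>" using tanh_real_lt_1[of "\<bar>x\<bar>"] by (intro divide_right_mono) auto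
  finally show ?thesis by (simp add: omega_abs)
qed

text \<open>The 1/6 is half of the 1/3 in tanh x / x = 1 - x^2 / 3 + ..., because of the square
  root; it becomes the 6 in the limiting phase. The limit is computed from the right and carried
  over by evenness.\<close>

lemma omega_asymp_0: "((\<lambda>x. (1 - omega x) / x\<^sup>2) \<longlongrightarrow> 1 / 6) (at 0)"
proof -
  have R: "((\<lambda>x. (1 - omega x) / x\<^sup>2) \<longlongrightarrow> 1 / 6) (at_right 0)"
  proof (rule Lim_transform_eventually)
    show "((\<lambda>x::real. (1 - sqrt ((exp x - exp (-x)) / (exp x + exp (-x)) / x)) / x\<^sup>2) \<longlongrightarrow> 1 / 6) (at_right 0)"
      by real_asymp
  qed (auto simp: eventually_at_filter omega_def tanh_altdef)
  have "((\<lambda>x. (1 - omega x) / x\<^sup>2) \<longlongrightarrow> 1 / 6) (at_left 0)"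
    using R by (simp add: filterlim_at_left_to_right omega_minus)
  then show ?thesis using R filterlim_split_at_real by blast
qed

lemma borel_measurable_omega[measurable]: "omega \<in> borel_measurable borel"
proof -
  have "(tanh :: real \<Rightarrow> real) \<in> borel_measurable borel"
    by (intro borel_measurable_continuous_onI continuous_intros) auto
  then show ?thesis unfolding omega_def[abs_def] by measurable
qed

section \<open>Bounds on the amplitude\<close>

text \<open>The mean of \<open>cis (s * b)\<close> over \<open>s\<close> in [-1, 0]; the value 1 at
  0 fills the removable singularity.\<close>

definition osc_mean :: "real \<Rightarrow> complex" where
  "osc_mean b = (if b = 0 then 1 else (1 - cis (- b)) / (\<i> * of_real b))"

lemma osc_mean_measurable[measurable]: "osc_mean \<in> borel_measurable borel"
  unfolding osc_mean_def[abs_def] by measurable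

lemma integral_cis_osc_mean:
  assumes t: "t > 0"
  shows "integral {-t..0} (\<lambda>s. cis (s * b)) = of_real t * osc_mean (t * b)"
proof (cases "b = 0")
  case True
  then show ?thesis using t by (simp add: osc_mean_def scaleR_conv_of_real)
next
  case False
  have "((\<lambda>s. cis (s * b)) has_integral cis (0 * b) / (\<i> * of_real b) - cis (- t * b) / (\<i> * of_real b)) {-t..0}"
  proof (rule fundamental_theorem_of_calculus)
    fix s
    have "((\<lambda>s. exp (\<i> * of_real b * of_real s)) has_vector_derivative
       \<i> * of_real b * exp (\<i> * of_real b * of_real s)) (at s within {-t..0})"
      by (auto intro!: derivative_eq_intros has_vector_derivative_real_field)
    then have "((\<lambda>s. exp (\<i> * of_real b * of_real s) / (\<i> * of_real b)) has_vector_derivative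
       \<i> * of_real b * exp (\<i> * of_real b * of_real s) / (\<i> * of_real b)) (at s within {-t..0})"
      by (rule has_vector_derivative_divide)
    then show "((\<lambda>s. cis (s * b) / (\<i> * of_real b)) has_vector_derivative cis (s * b)) (at s within {-t..0})"
      using False by (simp add: cis_conv_exp mult_ac)
  qed (use t in auto)
  then show ?thesis
    using False t by (simp add: integral_unique osc_mean_def field_simps)
qed

lemma cmod_osc_mean_le_1: "cmod (osc_mean b) \<le> 1"
proof -
  \<comment> \<open>On an interval of length 1, \<open>osc_mean b\<close> is the integral of a
    function of modulus 1.\<close>
  have "cmod (integral {-1..0} (\<lambda>s. cis (s * b))) \<le> integral {-1..0} (\<lambda>s::real. 1::real)"
    by (rule Henstock_Kurzweil_Integration.integral_norm_bound_integral) (auto intro!: integrable_continuous_interval continuous_intros)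
  then show ?thesis by (simp add: integral_cis_osc_mean)
qed

lemma cmod_osc_mean_le: "b \<noteq> 0 \<Longrightarrow> cmod (osc_mean b) \<le> 2 / \<bar>b\<bar>"
  using norm_triangle_ineq4[of 1 "cis (- b)"] by (simp add: osc_mean_def norm_divide norm_mult divide_right_mono)

section \<open>Pointwise bounds at low and high frequency\<close>

lemma zeta_hat_eq:
  assumes "t > 0"
  shows "zeta_hat \<mu> P0 t \<xi> = - (\<i> / 2) * of_real (\<xi> * omega (sqrt \<mu> * \<xi>)) * fourier P0 \<xi> * cis (- (t * \<xi>))
    * (of_real t * osc_mean (t * (\<xi> * (omega (sqrt \<mu> * \<xi>) - 1))))"
  unfolding zeta_hat_def integral_cis_osc_mean[OF assms, symmetric] by (simp add: mult.assoc)

lemma fourier_measurable_bounded: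
  assumes f: "integrable lebesgue f"
  shows "isCont (fourier f) \<xi>" "fourier f \<in> borel_measurable borel" "cmod (fourier f \<xi>) \<le> L1_norm f / (2 * pi)"
proof -
  have fm[measurable]: "f \<in> borel_measurable lebesgue" using f by auto
  obtain f' where f'[measurable]: "f' \<in> borel_measurable borel" and ae: "AE x in lebesgue. f x = f' x"
    using lebesgue_borel_version[OF fm] .
  have fi: "integrable lborel f'" using integral_lebesgue_borel_version(2)[OF fm f' ae] f by simp
  have eq: "fourier f = (\<lambda>\<xi>. fint f' \<xi> / of_real (2 * pi))"
    using fourier_eq_fint[OF fm f' ae] by auto
  show "isCont (fourier f) \<xi>" for \<xi> unfolding eq
    by (intro continuous_intros isCont_fint fi) auto
  then show "fourier f \<in> borel_measurable borel"
    by (intro borel_measurable_continuous_onI continuous_at_imp_continuous_on) auto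
  have "L1_norm f = (LINT x|lborel. cmod (f' x))"
    unfolding L1_norm_def using ae by (intro integral_lebesgue_borel_version(1)) auto
  then show "cmod (fourier f \<xi>) \<le> L1_norm f / (2 * pi)"
    using cmod_fint_le[of f' \<xi>] by (simp add: eq norm_divide norm_mult divide_right_mono)
qed

lemma zeta_hat_measurable:
  assumes "integrable lebesgue P0" "t > 0"
  shows "zeta_hat \<mu> P0 t \<in> borel_measurable borel"
proof -
  note [measurable] = fourier_measurable_bounded(2)[OF assms(1)]
  show ?thesis unfolding zeta_hat_eq[OF assms(2), abs_def] by measurable
qed

text \<open>At \<open>\<bar>\<xi>\<bar>\<close> of order 1/L the bounds 1 and 2/|b| for
  \<open>osc_mean\<close> balance. Both regimes are put under one Lorentzian of width 1/L, whose
  integral is explicit.\<close>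

lemma zeta_hat_low_bound:
  assumes P0: "integrable lebesgue P0" and t: "t > 0" and \<mu>: "\<mu> > 0" and L: "L > 0" "L ^ 3 = \<mu> * t"
    and \<xi>: "\<bar>sqrt \<mu> * \<xi>\<bar> \<le> 1"
  shows "cmod (zeta_hat \<mu> P0 t \<xi>) \<le> 24 * L1_norm P0 / pi * (t / L) * (1 / (1 + (L * \<xi>)\<^sup>2))"
proof -
  let ?N = "L1_norm P0 / (2 * pi)"
  let ?w = "omega (sqrt \<mu> * \<xi>)"
  have N: "0 \<le> ?N" by (simp add: L1_norm_def)
  let ?E = "cmod (osc_mean (t * (\<xi> * (?w - 1))))"
  have eq: "cmod (zeta_hat \<mu> P0 t \<xi>) = 1/2 * (\<bar>\<xi>\<bar> * ?w) * cmod (fourier P0 \<xi>) * (t * ?E)"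
    unfolding zeta_hat_eq[OF t] using t omega_nonneg[of "sqrt \<mu> * \<xi>"] by (simp add: norm_mult norm_divide abs_mult)
  also have "\<dots> \<le> 1/2 * (\<bar>\<xi>\<bar> * 1) * ?N * (t * ?E)"
    using fourier_measurable_bounded(3)[OF P0, of \<xi>] omega_le_1[of "sqrt \<mu> * \<xi>"] omega_nonneg[of "sqrt \<mu> * \<xi>"] t N
    by (intro mult_mono mult_left_mono mult_nonneg_nonneg) auto
  finally have 1: "cmod (zeta_hat \<mu> P0 t \<xi>) \<le> ?N * (\<bar>\<xi>\<bar> * t * ?E / 2)" by (simp add: mult_ac)
  have "\<bar>\<xi>\<bar> * t * ?E / 2 \<le> 48 * (t / L) * (1 / (1 + (L * \<xi>)\<^sup>2))" (is "?A \<le> ?B")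
  \<comment> \<open>Below 1/L the trivial bound on \<open>osc_mean\<close> suffices; above it the
    decay 2/|b| is combined with the quadratic gap.\<close>
  proof (cases "L * \<bar>\<xi>\<bar> \<le> 1")
    case True
    have "(L * \<xi>)\<^sup>2 \<le> 1" using True L by (simp add: abs_square_le_1 abs_mult)
    have "\<bar>\<xi>\<bar> \<le> 1 / L" using True L by (simp add: field_simps)
    have "\<bar>\<xi>\<bar> * t * ?E / 2 \<le> (1 / L) * t * 1 / 2"
      using \<open>\<bar>\<xi>\<bar> \<le> 1 / L\<close> t L cmod_osc_mean_le_1 by (intro divide_right_mono mult_mono) auto
    also have "\<dots> = 48 * (t / L) * (1 / 96)" by simp
    also have "\<dots> \<le> 48 * (t / L) * (1 / (1 + (L * \<xi>)\<^sup>2))"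
      using t L \<open>(L * \<xi>)\<^sup>2 \<le> 1\<close> by (intro mult_left_mono divide_left_mono) (auto simp: add_pos_nonneg)
    finally show ?thesis .
  next
    case False
    then have \<xi>0: "\<xi> \<noteq> 0" using L by auto
    have "(L * \<bar>\<xi>\<bar>)\<^sup>2 \<ge> 1" using False by (simp add: one_le_power)
    then have s1: "(L * \<xi>)\<^sup>2 \<ge> 1" by (simp add: power_mult_distrib)
    have gap: "1 - ?w \<ge> \<mu> * \<xi>\<^sup>2 / 24"
      using omega_gap_small[OF \<xi>] \<mu> by (simp add: power_mult_distrib)
    have pos: "\<mu> * \<xi>\<^sup>2 / 24 > 0" using \<mu> \<xi>0 by simp
    have b: "\<bar>t * (\<xi> * (?w - 1))\<bar> = t * \<bar>\<xi>\<bar> * (1 - ?w)"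
      using t gap pos by (simp add: abs_mult)
    have "?E \<le> 2 / \<bar>t * (\<xi> * (?w - 1))\<bar>"
      using gap pos t \<xi>0 by (intro cmod_osc_mean_le) auto
    also have "\<dots> \<le> 2 / (t * \<bar>\<xi>\<bar> * (\<mu> * \<xi>\<^sup>2 / 24))"
      unfolding b using gap pos t \<xi>0 by (intro divide_left_mono mult_left_mono mult_pos_pos) auto
    finally have "\<bar>\<xi>\<bar> * t * ?E / 2 \<le> \<bar>\<xi>\<bar> * t * (2 / (t * \<bar>\<xi>\<bar> * (\<mu> * \<xi>\<^sup>2 / 24))) / 2"
      using t by (intro divide_right_mono mult_left_mono) auto
    also have "\<dots> = 48 * (1 / (2 * \<mu> * \<xi>\<^sup>2))"
      using t \<xi>0 \<mu> by (simp add: field_simps)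
    \<comment> \<open>\<open>L ^ 3 = \<mu> * t\<close> brings in the scale \<open>L\<close>; writing
      twice the square as a sum lets one copy be lowered to 1 by \<open>s1\<close>.\<close>
    also have "1 / (2 * \<mu> * \<xi>\<^sup>2) = (t / L) * (1 / ((L * \<xi>)\<^sup>2 + (L * \<xi>)\<^sup>2))"
      using t \<xi>0 \<mu> L by (simp add: field_simps power2_eq_square power3_eq_cube)
    also have "48 * \<dots> \<le> 48 * ((t / L) * (1 / (1 + (L * \<xi>)\<^sup>2)))"
    proof -
      have "0 < (L * \<xi>)\<^sup>2 + (L * \<xi>)\<^sup>2" using s1 by linarith
      then have "0 < ((L * \<xi>)\<^sup>2 + (L * \<xi>)\<^sup>2) * (1 + (L * \<xi>)\<^sup>2)"
        by (intro mult_pos_pos add_pos_nonneg) auto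
      then show ?thesis using s1 t L by (intro mult_left_mono divide_left_mono) auto
    qed
    finally show ?thesis by simp
  qed
  then have "?N * ?A \<le> ?N * ?B" using N by (rule mult_left_mono)
  with 1 have "cmod (zeta_hat \<mu> P0 t \<xi>) \<le> ?N * ?B" by (rule order.trans)
  also have "?N * ?B = 24 * L1_norm P0 / pi * (t / L) * (1 / (1 + (L * \<xi>)\<^sup>2))" by (simp add: mult_ac)
  finally show ?thesis .
qed

text \<open>The decay of \<open>osc_mean\<close> cancels both \<open>t\<close> and
  \<open>\<xi>\<close>, leaving omega times the transform. The split pairs omega / |\<xi>| with
  |\<xi>| times the transform, each square integrable at high frequency; the weight \<open>a\<close>
  is left free to be chosen later.\<close>

lemma zeta_hat_high_bound:
  assumes t: "t > 0" and \<mu>: "\<mu> > 0" and a: "a > 0" and \<xi>: "\<bar>sqrt \<mu> * \<xi>\<bar> \<ge> 1"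
  shows "cmod (zeta_hat \<mu> P0 t \<xi>) \<le> 12 * (2 * a * \<mu> * (1 / (1 + (sqrt \<mu> * \<xi>)\<^sup>2)) + (\<xi> * cmod (fourier P0 \<xi>))\<^sup>2 / a)"
proof -
  let ?w = "omega (sqrt \<mu> * \<xi>)" and ?p = "cmod (fourier P0 \<xi>)"
  define x where "x = \<bar>sqrt \<mu> * \<xi>\<bar>"
  have x: "x \<ge> 1" using \<xi> by (simp add: x_def)
  have x2: "x\<^sup>2 = \<mu> * \<xi>\<^sup>2" using \<mu> by (simp add: x_def power_mult_distrib)
  have \<xi>0: "\<xi> \<noteq> 0" using \<xi> by auto
  let ?E = "cmod (osc_mean (t * (\<xi> * (?w - 1))))"
  have gap: "1 - ?w \<ge> 1 / 24" using omega_gap_large[OF \<xi>] .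
  have b: "\<bar>t * (\<xi> * (?w - 1))\<bar> = t * \<bar>\<xi>\<bar> * (1 - ?w)"
    using t gap by (simp add: abs_mult)
  have "?E \<le> 2 / \<bar>t * (\<xi> * (?w - 1))\<bar>"
    using gap t \<xi>0 by (intro cmod_osc_mean_le) auto
  also have "\<dots> \<le> 2 / (t * \<bar>\<xi>\<bar> * (1 / 24))"
    unfolding b using gap t \<xi>0 by (intro divide_left_mono mult_left_mono mult_pos_pos) auto
  finally have E: "?E \<le> 48 / (t * \<bar>\<xi>\<bar>)" by simp
  have "cmod (zeta_hat \<mu> P0 t \<xi>) = 1/2 * (\<bar>\<xi>\<bar> * ?w) * ?p * (t * ?E)"
    unfolding zeta_hat_eq[OF t] using t omega_nonneg[of "sqrt \<mu> * \<xi>"] by (simp add: norm_mult norm_divide abs_mult)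
  also have "\<dots> \<le> 1/2 * (\<bar>\<xi>\<bar> * ?w) * ?p * (t * (48 / (t * \<bar>\<xi>\<bar>)))"
    using E t omega_nonneg[of "sqrt \<mu> * \<xi>"] by (intro mult_left_mono mult_nonneg_nonneg) auto
  also have "\<dots> = 12 * (2 * (?w / \<bar>\<xi>\<bar>) * (\<bar>\<xi>\<bar> * ?p))" using t \<xi>0 by (simp add: field_simps)
  also have "2 * (?w / \<bar>\<xi>\<bar>) * (\<bar>\<xi>\<bar> * ?p) \<le> a * (?w / \<bar>\<xi>\<bar>)\<^sup>2 + (\<bar>\<xi>\<bar> * ?p)\<^sup>2 / a"
    \<comment> \<open>AM-GM with weight \<open>a\<close>\<close>
  proof -
    have "0 \<le> (a * (?w / \<bar>\<xi>\<bar>) - \<bar>\<xi>\<bar> * ?p)\<^sup>2 / a" using a by simp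
    also have "\<dots> = a * (?w / \<bar>\<xi>\<bar>)\<^sup>2 + (\<bar>\<xi>\<bar> * ?p)\<^sup>2 / a - 2 * (?w / \<bar>\<xi>\<bar>) * (\<bar>\<xi>\<bar> * ?p)"
      using a by (simp add: power2_diff diff_divide_distrib add_divide_distrib) (simp add: power2_eq_square)
    finally show ?thesis by simp
  qed
  \<comment> \<open>From omega^2 \<le> 1/x the left side is at most mu / x^3, which is weakened to a
    Lorentzian with known integral.\<close>
  also have "(?w / \<bar>\<xi>\<bar>)\<^sup>2 \<le> 2 * \<mu> * (1 / (1 + x\<^sup>2))"
  proof -
    have "x * 1 \<le> x * x" using x by (intro mult_left_mono) auto
    then have "1 + x\<^sup>2 \<le> 2 * x\<^sup>2" using x unfolding power2_eq_square by linarith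
    also have "\<dots> \<le> 2 * x ^ 3" using x power_increasing[of 2 3 x] by simp
    finally have c: "1 + x\<^sup>2 \<le> 2 * x ^ 3" .
    have "?w\<^sup>2 \<le> 1 / x" unfolding x_def by (rule omega_sq_le) (use \<xi> in auto)
    then have "(?w / \<bar>\<xi>\<bar>)\<^sup>2 \<le> 1 / x / \<xi>\<^sup>2" unfolding power_divide power2_abs by (rule divide_right_mono) auto
    also have "\<dots> = 2 * \<mu> * (1 / (2 * x ^ 3))"
    proof -
      have "x ^ 3 = x * (\<mu> * \<xi>\<^sup>2)" using x2 by (simp add: power3_eq_cube power2_eq_square)
      then show ?thesis using \<mu> \<xi>0 x by simp
    qed
    also have "\<dots> \<le> 2 * \<mu> * (1 / (1 + x\<^sup>2))"
      using c \<mu> x by (intro mult_left_mono divide_left_mono) (auto simp: add_pos_nonneg)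
    finally show ?thesis .
  qed
  finally show ?thesis using a by (simp add: x_def power_mult_distrib mult_left_mono)
qed

section \<open>Integrating the frequency bounds\<close>

lemma lborel_inverse_1_plus_square:
  assumes "c > 0"
  shows "integrable lborel (\<lambda>x. 1 / (1 + (c * x)\<^sup>2))" "(LINT x|lborel. 1 / (1 + (c * x)\<^sup>2)) = pi / c"
proof -
  have i: "integrable lborel (\<lambda>x::real. 1 / (1 + x\<^sup>2))"
    using integrable_inverse_1_plus_square by (simp add: set_integrable_def einterval_def inverse_eq_divide)
  have v: "(LINT x|lborel. 1 / (1 + x\<^sup>2)) = pi"
    using LBINT_inverse_1_plus_square
    by (simp add: interval_lebesgue_integral_def set_lebesgue_integral_def einterval_def inverse_eq_divide)
  show "integrable lborel (\<lambda>x. 1 / (1 + (c * x)\<^sup>2))"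
    using lborel_integrable_real_affine[OF i, of c 0] assms by simp
  show "(LINT x|lborel. 1 / (1 + (c * x)\<^sup>2)) = pi / c"
    using lborel_integral_real_affine[of c "\<lambda>x. 1 / (1 + x\<^sup>2)" 0] assms v by (simp add: field_simps)
qed

text \<open>The high-frequency majorant. It is free of \<open>t\<close>, so it yields a remainder
  that division by t^(1/3) removes.\<close>

definition zeta_bound :: "real \<Rightarrow> (real \<Rightarrow> complex) \<Rightarrow> real \<Rightarrow> real \<Rightarrow> real" where
  "zeta_bound \<mu> P0 a \<xi> = 12 * (2 * a * \<mu> * (1 / (1 + (sqrt \<mu> * \<xi>)\<^sup>2)) + (\<xi> * cmod (fourier P0 \<xi>))\<^sup>2 / a)"

lemma zeta_bound_nonneg: "\<mu> > 0 \<Longrightarrow> a > 0 \<Longrightarrow> 0 \<le> zeta_bound \<mu> P0 a \<xi>"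
  by (auto simp: zeta_bound_def intro!: add_nonneg_nonneg)

text \<open>The Lorentzian integrates to pi / sqrt mu; the second term is controlled by the L^2 norm
  of the weak derivative, which the H^1 norm dominates.\<close>

lemma zeta_bound_integral:
  assumes P0: "integrable lebesgue P0" "in_H1 P0" and \<mu>: "\<mu> > 0" and a: "a > 0"
  shows "integrable lborel (zeta_bound \<mu> P0 a)"
    and "(LINT \<xi>|lborel. zeta_bound \<mu> P0 a \<xi>) \<le> 12 * (2 * pi * a * sqrt \<mu> + (H1_norm P0)\<^sup>2 / (2 * pi) / a)"
proof -
  \<comment> \<open>Existence makes the arbitrary choice in \<open>weak_deriv\<close> an actual weak
    derivative.\<close>
  have "\<exists>g. has_L2_weak_deriv P0 g" using P0 by (simp add: in_H1_def)
  then have wd: "has_L2_weak_deriv P0 (weak_deriv P0)" unfolding weak_deriv_def by (rule someI_ex)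
  note F = fourier_weak_deriv_L2[OF P0(1) wd]
  have s: "sqrt \<mu> > 0" using \<mu> by simp
  note B = lborel_inverse_1_plus_square[OF s]
  show "integrable lborel (zeta_bound \<mu> P0 a)"
    unfolding zeta_bound_def[abs_def] using F(1) B(1)
    by (intro integrable_mult_right Bochner_Integration.integrable_add integrable_divide) auto
  have lin: "(LINT \<xi>|lborel. 12 * (2 * a * \<mu> * f \<xi> + g \<xi> / a)) = 12 * (2 * a * \<mu> * (LINT \<xi>|lborel. f \<xi>) + (LINT \<xi>|lborel. g \<xi>) / a)"
    if "integrable lborel f" "integrable lborel g" for f g :: "real \<Rightarrow> real"
    using that by simp
  have "(LINT \<xi>|lborel. zeta_bound \<mu> P0 a \<xi>) = 12 * (2 * a * \<mu> * (pi / sqrt \<mu>) + (LINT \<xi>|lborel. (\<xi> * cmod (fourier P0 \<xi>))\<^sup>2) / a)"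
    unfolding zeta_bound_def B(2)[symmetric] by (rule lin[OF B(1) F(1)])
  also have "2 * a * \<mu> * (pi / sqrt \<mu>) = 2 * pi * a * sqrt \<mu>"
    using real_div_sqrt[of \<mu>] \<mu> by (simp add: field_simps)
  also have "(LINT \<xi>|lborel. (\<xi> * cmod (fourier P0 \<xi>))\<^sup>2) \<le> (H1_norm P0)\<^sup>2 / (2 * pi)"
  proof -
    have "(H1_norm P0)\<^sup>2 = (LINT x|lebesgue. (cmod (P0 x))\<^sup>2) + (LINT x|lebesgue. (cmod (weak_deriv P0 x))\<^sup>2)"
      unfolding H1_norm_def by (intro real_sqrt_pow2 add_nonneg_nonneg integral_nonneg) auto
    then have "(LINT x|lebesgue. (cmod (weak_deriv P0 x))\<^sup>2) \<le> (H1_norm P0)\<^sup>2" by simp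
    then show ?thesis using F(2) by (simp add: divide_right_mono order.trans[OF F(2)])
  qed
  finally show "(LINT \<xi>|lborel. zeta_bound \<mu> P0 a \<xi>) \<le> 12 * (2 * pi * a * sqrt \<mu> + (H1_norm P0)\<^sup>2 / (2 * pi) / a)"
    using a by (simp add: divide_right_mono)
qed

text \<open>Both pointwise bounds are nonnegative, so their sum is a majorant at every frequency.
  The Lorentzian contributes a multiple of t / L^2, which equals t^(1/3) mu^(-2/3).\<close>

lemma zeta_hat_integrable:
  assumes P0: "integrable lebesgue P0" "in_H1 P0" and \<mu>: "\<mu> > 0" and t: "t > 0" and L: "L > 0" "L ^ 3 = \<mu> * t" and a: "a > 0"
  shows "integrable lborel (zeta_hat \<mu> P0 t)"
    and "(LINT \<xi>|lborel. cmod (zeta_hat \<mu> P0 t \<xi>)) \<le> 24 * L1_norm P0 * (t / L\<^sup>2) + (LINT \<xi>|lborel. zeta_bound \<mu> P0 a \<xi>)"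
proof -
  note [measurable] = zeta_hat_measurable[OF P0(1) t]
  let ?l = "\<lambda>\<xi>. 24 * L1_norm P0 / pi * (t / L) * (1 / (1 + (L * \<xi>)\<^sup>2))"
  note B = lborel_inverse_1_plus_square[OF L(1)] 
  have il: "integrable lborel ?l" using B by (intro integrable_mult_right) auto
  have l0: "0 \<le> ?l \<xi>" for \<xi> using t L by (auto simp: L1_norm_def intro!: mult_nonneg_nonneg divide_nonneg_nonneg)
  have i: "integrable lborel (\<lambda>\<xi>. ?l \<xi> + zeta_bound \<mu> P0 a \<xi>)"
    using il zeta_bound_integral(1)[OF P0 \<mu> a] by (rule Bochner_Integration.integrable_add)
  have le: "cmod (zeta_hat \<mu> P0 t \<xi>) \<le> ?l \<xi> + zeta_bound \<mu> P0 a \<xi>" for \<xi>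
  proof (cases "\<bar>sqrt \<mu> * \<xi>\<bar> \<le> 1")
    case True
    show ?thesis using zeta_hat_low_bound[OF P0(1) t \<mu> L True] zeta_bound_nonneg[OF \<mu> a, of P0 \<xi>] by simp
  next
    case False
    then have "\<bar>sqrt \<mu> * \<xi>\<bar> \<ge> 1" by simp
    from zeta_hat_high_bound[OF t \<mu> a this] l0[of \<xi>] show ?thesis unfolding zeta_bound_def by (rule order.trans[OF _ add_increasing]) auto
  qed
  show 1: "integrable lborel (zeta_hat \<mu> P0 t)"
    using i by (rule Bochner_Integration.integrable_bound) (use le in \<open>auto intro!: AE_I2 order.trans[OF le]\<close>)
  have "(LINT \<xi>|lborel. cmod (zeta_hat \<mu> P0 t \<xi>)) \<le> (LINT \<xi>|lborel. ?l \<xi> + zeta_bound \<mu> P0 a \<xi>)"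
    using 1 i le by (intro integral_mono) auto
  also have "\<dots> = (LINT \<xi>|lborel. ?l \<xi>) + (LINT \<xi>|lborel. zeta_bound \<mu> P0 a \<xi>)"
    using il zeta_bound_integral(1)[OF P0 \<mu> a] by (rule Bochner_Integration.integral_add)
  also have "(LINT \<xi>|lborel. ?l \<xi>) = 24 * L1_norm P0 * (t / L\<^sup>2)"
    by (subst integral_mult_right_zero) (use B L in \<open>auto simp: power2_eq_square\<close>)
  finally show "(LINT \<xi>|lborel. cmod (zeta_hat \<mu> P0 t \<xi>)) \<le> 24 * L1_norm P0 * (t / L\<^sup>2) + (LINT \<xi>|lborel. zeta_bound \<mu> P0 a \<xi>)" .
qed

section \<open>Continuity and the supremum norm\<close>

lemma zeta_R_eq_fint:
  assumes "integrable lebesgue P0" "t > 0"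
  shows "zeta_R \<mu> P0 t X = fint (zeta_hat \<mu> P0 t) (- X)"
proof -
  note [measurable] = zeta_hat_measurable[OF assms]
  show ?thesis unfolding zeta_R_def inv_fourier_def fint_def
    by (subst integral_completion) (auto simp: mult_ac)
qed

lemma Linf_norm_le:
  assumes "continuous_on UNIV f" "\<And>x. cmod (f x) \<le> c"
  shows "Linf_norm f \<le> ereal c"
proof -
  have "f \<in> borel_measurable lebesgue"
    using assms(1) by (intro borel_imp_lebesgue_measurable borel_measurable_continuous_onI)
  then show ?thesis unfolding Linf_norm_def using assms(2) by (intro esssup_I) auto
qed

text \<open>The set where the modulus exceeds the essential supremum is open by continuity and null,
  hence empty.\<close>

lemma Linf_norm_ge:
  assumes f: "continuous_on UNIV f"
  shows "ereal (cmod (f x)) \<le> Linf_norm f"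
proof (rule ccontr)
  let ?U = "{y. Linf_norm f < ereal (cmod (f y))}"
  assume "\<not> ereal (cmod (f x)) \<le> Linf_norm f"
  then have "x \<in> ?U" by auto
  moreover have o: "open ?U" by (intro open_Collect_less continuous_intros f)
  ultimately have "\<not> negligible ?U" using open_not_negligible by blast
  moreover have "AE y in lebesgue. ereal (cmod (f y)) \<le> Linf_norm f"
    unfolding Linf_norm_def by (rule esssup_AE)
  then have "AE y in lebesgue. y \<notin> ?U" by eventually_elim auto
  then have "?U \<in> null_sets lebesgue"
    using o by (subst (asm) AE_iff_null_sets[symmetric]) auto
  ultimately show False by (simp add: negligible_iff_null_sets)
qed

lemma continuous_zeta_R:
  assumes "integrable lebesgue P0" "t > 0" "integrable lborel (zeta_hat \<mu> P0 t)"
  shows "continuous_on UNIV (zeta_R \<mu> P0 t)"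
proof -
  have "isCont (\<lambda>X. fint (zeta_hat \<mu> P0 t) (- X)) x" for x
    by (intro continuous_intros isCont_o2[OF _ isCont_fint[OF assms(3)]])
  then show ?thesis
    unfolding zeta_R_eq_fint[OF assms(1,2), abs_def] by (auto intro: continuous_at_imp_continuous_on)
qed

section \<open>The limit along the diagonal\<close>

text \<open>The limiting low-frequency integrand at X = t, up to the factor mu^(-2/3) and the
  transform of \<open>P0\<close> at 0, with frequency measured in units of 1/L.\<close>

definition diagonal_profile :: "real \<Rightarrow> complex" where
  "diagonal_profile \<sigma> = - (\<i> / 2) * of_real \<sigma> * osc_mean (- (\<sigma> ^ 3 / 6))"

text \<open>The universal constant of the lower bound. The real part is taken because it is
  nonnegative pointwise and its integral bounds the modulus of the full integral from below.\<close>

definition diagonal_const :: real where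
  "diagonal_const = (LINT \<sigma>|lborel. Re (diagonal_profile \<sigma>))"

lemma diagonal_profile_measurable[measurable]: "diagonal_profile \<in> borel_measurable borel"
  unfolding diagonal_profile_def[abs_def] by measurable

text \<open>The same two regimes as in the low-frequency bound, now split at |\<sigma>| = 1.\<close>

lemma diagonal_profile_bound: "cmod (diagonal_profile \<sigma>) \<le> 12 * (1 / (1 + (1 * \<sigma>)\<^sup>2))"
proof (cases "\<bar>\<sigma>\<bar> \<le> 1")
  case True
  then have "\<sigma>\<^sup>2 \<le> 1" by (simp add: abs_square_le_1)
  then have "1/2 \<le> 12 * (1 / (1 + (1 * \<sigma>)\<^sup>2))" by (simp add: field_simps add_pos_nonneg)
  moreover have "cmod (diagonal_profile \<sigma>) \<le> 1/2 * 1 * 1"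
    unfolding diagonal_profile_def norm_mult using True cmod_osc_mean_le_1
    by (intro mult_mono) (auto simp: norm_divide)
  ultimately show ?thesis by simp
next
  case False
  then have "cmod (osc_mean (- (\<sigma> ^ 3 / 6))) \<le> 2 / \<bar>- (\<sigma> ^ 3 / 6)\<bar>"
    by (intro cmod_osc_mean_le) auto
  then have "cmod (diagonal_profile \<sigma>) \<le> 1/2 * \<bar>\<sigma>\<bar> * (2 / \<bar>- (\<sigma> ^ 3 / 6)\<bar>)"
    unfolding diagonal_profile_def norm_mult by (intro mult_mono) (auto simp: norm_divide)
  also have "\<dots> = 12 * (1 / (\<sigma>\<^sup>2 + \<sigma>\<^sup>2))"
    using False by (simp add: abs_mult power2_eq_square power3_eq_cube field_simps)
  also have "\<dots> \<le> 12 * (1 / (1 + (1 * \<sigma>)\<^sup>2))"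
  proof -
    have s: "1 \<le> \<sigma>\<^sup>2" using False abs_square_le_1[of \<sigma>] by linarith
    then have "0 < (\<sigma>\<^sup>2 + \<sigma>\<^sup>2) * (1 + (1 * \<sigma>)\<^sup>2)" by (intro mult_pos_pos) auto
    then show ?thesis using s by (intro mult_left_mono divide_left_mono) auto
  qed
  finally show ?thesis .
qed

lemma diagonal_profile_integrable: "integrable lborel diagonal_profile"
proof (rule Bochner_Integration.integrable_bound)
  show "integrable lborel (\<lambda>\<sigma>::real. 12 * (1 / (1 + (1 * \<sigma>)\<^sup>2)))"
    by (intro integrable_mult_right lborel_inverse_1_plus_square) auto
  show "AE \<sigma> in lborel. norm (diagonal_profile \<sigma>) \<le> norm (12 * (1 / (1 + (1 * \<sigma>)\<^sup>2)))"
    using order.trans[OF diagonal_profile_bound abs_ge_self] by (intro AE_I2) (simp only: real_norm_def)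
qed measurable

lemma Re_diagonal_profile: "\<sigma> \<noteq> 0 \<Longrightarrow> Re (diagonal_profile \<sigma>) = 3 * (1 - cos (\<sigma> ^ 3 / 6)) / \<sigma>\<^sup>2"
proof -
  assume s: "\<sigma> \<noteq> 0"
  have "diagonal_profile \<sigma> = of_real (3 / \<sigma>\<^sup>2) * (1 - cis (\<sigma> ^ 3 / 6))"
    using s by (simp add: diagonal_profile_def osc_mean_def field_simps power2_eq_square power3_eq_cube)
  then show ?thesis by simp
qed

lemma diagonal_const_pos: "diagonal_const > 0"
proof -
  \<comment> \<open>On [1, 2] the phase lies between 1/6 and 4/3 < pi, so its cosine is at most cos
    (1/6), and the denominator is at most 4.\<close>
  let ?c = "3 * (1 - cos (1/6)) / 4 :: real"
  have c: "cos (1/6 :: real) < 1" using cos_monotone_0_pi[of 0 "1/6"] pi_gt3 by simp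
  have "integrable lborel (\<lambda>\<sigma>. Re (diagonal_profile \<sigma>))" using diagonal_profile_integrable by auto
  moreover have "indicator {1..2} \<sigma> * ?c \<le> Re (diagonal_profile \<sigma>)" for \<sigma> :: real
  proof (cases "\<sigma> \<in> {1..2}")
    case True
    have "1 \<le> \<sigma> ^ 3" "\<sigma> ^ 3 \<le> 2 ^ 3" "\<sigma>\<^sup>2 \<le> 2\<^sup>2"
      using True power_mono[of \<sigma> 2 3] power_mono[of \<sigma> 2 2] one_le_power[of \<sigma> 3] by auto
    then have "cos (\<sigma> ^ 3 / 6) \<le> cos (1 / 6)"
      using pi_gt3 by (intro cos_monotone_0_pi_le) auto
    moreover have "\<sigma>\<^sup>2 > 0" using True by simp
    ultimately have "3 * (1 - cos (1/6)) / 4 \<le> 3 * (1 - cos (\<sigma> ^ 3 / 6)) / \<sigma>\<^sup>2"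
      using \<open>\<sigma>\<^sup>2 \<le> 2\<^sup>2\<close> c by (intro frac_le) auto
    then show ?thesis using True by (simp add: Re_diagonal_profile)
  next
    case False
    then have "Re (diagonal_profile \<sigma>) \<ge> 0"
      by (cases "\<sigma> = 0") (simp add: diagonal_profile_def, simp add: Re_diagonal_profile)
    then show ?thesis using False by simp
  qed
  ultimately have "(LINT \<sigma>|lborel. indicator {1..2::real} \<sigma> * ?c) \<le> diagonal_const"
    unfolding diagonal_const_def by (intro integral_mono) (auto simp: emeasure_lborel_Icc_eq)
  then show ?thesis using c by simp
qed

section \<open>Convergence of the rescaled low frequencies\<close>

lemma omega_tendsto_1: "(omega \<longlongrightarrow> 1) (at 0)"
proof -
  have "((\<lambda>x. 1 - (1 - omega x) / x\<^sup>2 * x\<^sup>2) \<longlongrightarrow> 1 - 1/6 * 0\<^sup>2) (at 0)"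
    by (intro tendsto_intros omega_asymp_0)
  then have "(omega \<longlongrightarrow> 1 - 1/6 * 0\<^sup>2) (at 0)"
    by (rule Lim_transform_eventually) (auto simp: eventually_at_filter)
  then show ?thesis by simp
qed

lemma isCont_osc_mean: "b \<noteq> 0 \<Longrightarrow> isCont osc_mean b"
proof -
  assume b: "b \<noteq> 0"
  have "isCont (\<lambda>b. (1 - cis (- b)) / (\<i> * of_real b)) b"
    unfolding cis_conv_exp using b by (intro continuous_intros) auto
  moreover have "eventually (\<lambda>x. osc_mean x = (1 - cis (- x)) / (\<i> * of_real x)) (nhds b)"
    using eventually_nhds_in_open[of "- {0}" b] b
    by (auto elim!: eventually_mono simp: osc_mean_def open_Compl)
  ultimately show ?thesis by (subst isCont_cong)
qed

text \<open>Evaluation at X = t supplies \<open>cis (t * \<xi>)\<close>, which cancels the transport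
  factor of \<open>zeta_hat\<close>. After \<xi> = \<sigma> / L the low-frequency majorant no longer
  depends on \<open>t\<close>, so dominated convergence applies.\<close>

lemma low_frequency_limit:
  assumes P0: "integrable lebesgue P0" and \<mu>: "\<mu> > 0"
  defines "F \<equiv> \<lambda>t \<xi>. indicator {\<xi>. \<bar>sqrt \<mu> * \<xi>\<bar> \<le> 1} \<xi> *\<^sub>R (cis (t * \<xi>) * zeta_hat \<mu> P0 t \<xi>)"
  shows "((\<lambda>t. of_real (1 / t powr (1/3)) * (LINT \<xi>|lborel. F t \<xi>)) \<longlongrightarrow>
    of_real (1 / \<mu> powr (2/3)) * fourier P0 0 * (LINT \<sigma>|lborel. diagonal_profile \<sigma>)) at_top"
proof -
  define L where "L t = (\<mu> * t) powr (1/3)" for t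
  have L: "L t > 0" "L t ^ 3 = \<mu> * t" "(L t)\<^sup>2 = \<mu> powr (2/3) * t powr (2/3)" if "t > 0" for t
    using that \<mu> by (auto simp: L_def powr_realpow[symmetric] powr_powr powr_mult)
  have scale: "t / ((L t)\<^sup>2 * t powr (1/3)) = 1 / \<mu> powr (2/3)" if "t > 0" for t
  proof -
    have "t powr (2/3) * t powr (1/3) = t" using that by (simp add: powr_add[symmetric])
    then show ?thesis using that \<mu> by (simp add: L(3) field_simps)
  qed
  \<comment> \<open>The constant in front joins the Jacobian 1/L to the normalisation
    t^(-1/3).\<close>
  define G where "G t \<sigma> = of_real (1 / (t powr (1/3) * L t)) * F t (\<sigma> / L t)" for t \<sigma>
  define g where "g \<sigma> = of_real (1 / \<mu> powr (2/3)) * fourier P0 0 * diagonal_profile \<sigma>" for \<sigma>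
  note [measurable] = fourier_measurable_bounded(2)[OF P0]
  have Fm[measurable]: "F t \<in> borel_measurable borel" if "t > 0" for t
  proof -
    note [measurable] = zeta_hat_measurable[OF P0 that]
    show ?thesis unfolding F_def by measurable
  qed
  have Ltop: "filterlim L at_top at_top"
    unfolding L_def using \<mu> by real_asymp
  \<comment> \<open>\<open>max 1 t\<close> keeps the time positive, as measurability has to hold for
    every \<open>t\<close> and not only eventually.\<close>
  have "((\<lambda>t. LINT \<sigma>|lborel. G (max 1 t) \<sigma>) \<longlongrightarrow> (LINT \<sigma>|lborel. g \<sigma>)) at_top"
  proof (rule integral_dominated_convergence_at_top)
    show "g \<in> borel_measurable lborel" unfolding g_def[abs_def] by measurable
    show "G (max 1 t) \<in> borel_measurable lborel" for t
      unfolding G_def[abs_def] by measurable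
    show "integrable lborel (\<lambda>\<sigma>. 24 * L1_norm P0 / pi * (1 / \<mu> powr (2/3)) * (1 / (1 + (1 * \<sigma>)\<^sup>2)))"
      by (intro integrable_mult_right lborel_inverse_1_plus_square) auto
    show "\<forall>\<^sub>F t in at_top. AE \<sigma> in lborel. norm (G (max 1 t) \<sigma>) \<le> 24 * L1_norm P0 / pi * (1 / \<mu> powr (2/3)) * (1 / (1 + (1 * \<sigma>)\<^sup>2))"
    proof (intro always_eventually allI AE_I2)
      fix t0 \<sigma> :: real
      define t where "t = max 1 t0"
      have t: "t > 0" by (simp add: t_def)
      have b0: "0 \<le> 24 * L1_norm P0 / pi * (t / L t) * (1 / (1 + (L t * (\<sigma> / L t))\<^sup>2))"
        using t L(1)[OF t] by (auto simp: L1_norm_def intro!: mult_nonneg_nonneg divide_nonneg_nonneg)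
      have "cmod (F t (\<sigma> / L t)) \<le> 24 * L1_norm P0 / pi * (t / L t) * (1 / (1 + (L t * (\<sigma> / L t))\<^sup>2))"
        unfolding F_def using zeta_hat_low_bound[OF P0 t \<mu> L(1)[OF t] L(2)[OF t], of "\<sigma> / L t"] b0
        by (auto simp: indicator_def norm_mult)
      then have "cmod (F t (\<sigma> / L t)) / (t powr (1/3) * L t) \<le> 24 * L1_norm P0 / pi * (t / L t) * (1 / (1 + (L t * (\<sigma> / L t))\<^sup>2)) / (t powr (1/3) * L t)"
        using t L(1)[OF t] by (intro divide_right_mono) auto
      also have "\<dots> = 24 * L1_norm P0 / pi * (t / ((L t)\<^sup>2 * t powr (1/3))) * (1 / (1 + (1 * \<sigma>)\<^sup>2))"
        using t L(1)[OF t] by (simp add: power2_eq_square mult_ac)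
      finally have "cmod (F t (\<sigma> / L t)) / (t powr (1/3) * L t) \<le> 24 * L1_norm P0 / pi * (1 / \<mu> powr (2/3)) * (1 / (1 + (1 * \<sigma>)\<^sup>2))"
        by (simp only: scale[OF t])
      then show "norm (G (max 1 t0) \<sigma>) \<le> 24 * L1_norm P0 / pi * (1 / \<mu> powr (2/3)) * (1 / (1 + (1 * \<sigma>)\<^sup>2))"
        using t L(1)[OF t] unfolding G_def t_def[symmetric] norm_mult norm_of_real by simp
    qed
    show "AE \<sigma> in lborel. ((\<lambda>t. G (max 1 t) \<sigma>) \<longlongrightarrow> g \<sigma>) at_top"
    proof -
      \<comment> \<open>Leaving out 0 keeps the limiting phase nonzero, where
        \<open>isCont_osc_mean\<close> applies, and permits division by the square of
        \<open>?x t\<close>.\<close>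
      have "AE \<sigma>::real in lborel. \<sigma> \<noteq> 0" by (rule AE_lborel_singleton)
      then show ?thesis
      proof eventually_elim
        case (elim \<sigma>)
        let ?x = "\<lambda>t. sqrt \<mu> * (\<sigma> / L t)"
        have z: "((\<lambda>t. \<sigma> / L t) \<longlongrightarrow> 0) at_top"
          by (rule real_tendsto_divide_at_top[OF tendsto_const Ltop])
        then have "(?x \<longlongrightarrow> sqrt \<mu> * 0) at_top" by (intro tendsto_intros)
        moreover have "eventually (\<lambda>t. ?x t \<noteq> 0) at_top"
          using eventually_gt_at_top[of 0] by eventually_elim (use elim \<mu> L(1) in \<open>force\<close>)
        ultimately have x: "filterlim ?x (at 0) at_top" by (simp add: filterlim_at)
        have 1: "((\<lambda>t. omega (?x t)) \<longlongrightarrow> 1) at_top" by (rule filterlim_compose[OF omega_tendsto_1 x])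
        have 2: "((\<lambda>t. (1 - omega (?x t)) / (?x t)\<^sup>2) \<longlongrightarrow> 1/6) at_top" by (rule filterlim_compose[OF omega_asymp_0 x])
        have 3: "((\<lambda>t. fourier P0 (\<sigma> / L t)) \<longlongrightarrow> fourier P0 0) at_top"
          by (rule isCont_tendsto_compose[OF fourier_measurable_bounded(1)[OF P0] z])
        have "((\<lambda>t. - (\<sigma> ^ 3 * ((1 - omega (?x t)) / (?x t)\<^sup>2))) \<longlongrightarrow> - (\<sigma> ^ 3 * (1/6))) at_top"
          by (intro tendsto_intros 2)
        then have 4: "((\<lambda>t. osc_mean (- (\<sigma> ^ 3 * ((1 - omega (?x t)) / (?x t)\<^sup>2)))) \<longlongrightarrow> osc_mean (- (\<sigma> ^ 3 * (1/6)))) at_top"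
          by (rule isCont_tendsto_compose[OF isCont_osc_mean, rotated]) (use elim in auto)
        have "((\<lambda>t. - (\<i> / 2) * of_real (1 / \<mu> powr (2/3) * (\<sigma> * omega (?x t))) * fourier P0 (\<sigma> / L t)
            * osc_mean (- (\<sigma> ^ 3 * ((1 - omega (?x t)) / (?x t)\<^sup>2))))
          \<longlongrightarrow> - (\<i> / 2) * of_real (1 / \<mu> powr (2/3) * (\<sigma> * 1)) * fourier P0 0 * osc_mean (- (\<sigma> ^ 3 * (1/6)))) at_top"
          by (intro tendsto_mult tendsto_const tendsto_of_real 1 3 4)
        moreover have "- (\<i> / 2) * of_real (1 / \<mu> powr (2/3) * (\<sigma> * 1)) * fourier P0 0 * osc_mean (- (\<sigma> ^ 3 * (1/6))) = g \<sigma>"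
          by (simp add: g_def diagonal_profile_def mult_ac)
        moreover have "eventually (\<lambda>t. - (\<i> / 2) * of_real (1 / \<mu> powr (2/3) * (\<sigma> * omega (?x t))) * fourier P0 (\<sigma> / L t)
            * osc_mean (- (\<sigma> ^ 3 * ((1 - omega (?x t)) / (?x t)\<^sup>2))) = G (max 1 t) \<sigma>) at_top"
        proof -
          \<comment> \<open>The rescaled frequency eventually lies below the cutoff, so the
            indicator in \<open>F\<close> is 1.\<close>
          have "(?x \<longlongrightarrow> 0) at_top" using x by (simp add: filterlim_at)
          then have "((\<lambda>t. \<bar>?x t\<bar>) \<longlongrightarrow> \<bar>0\<bar>) at_top" by (rule tendsto_rabs)
          then have "eventually (\<lambda>t. \<bar>?x t\<bar> < 1) at_top"
            by (rule order_tendstoD(2)) simp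
          then show ?thesis
            using eventually_ge_at_top[of 1]
          proof eventually_elim
            case (elim t)
            then have t: "t > 0" and m: "max 1 t = t" by auto
            \<comment> \<open>This form isolates the quotient with limit 1/6;
              \<open>L t ^ 3 = \<mu> * t\<close> makes the remaining coefficient exactly
              \<open>\<sigma> ^ 3\<close>.\<close>
            have "t * (\<sigma> / L t * (omega (?x t) - 1)) = - (\<sigma> ^ 3 * ((1 - omega (?x t)) / (?x t)\<^sup>2))"
            proof -
              have "(?x t)\<^sup>2 = \<mu> * \<sigma>\<^sup>2 / (L t)\<^sup>2" using \<mu> by (simp add: power_mult_distrib power_divide)
              then have "\<sigma> ^ 3 * ((1 - omega (?x t)) / (?x t)\<^sup>2) = \<sigma> * (1 - omega (?x t)) * (L t)\<^sup>2 / \<mu>"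
                using \<open>\<sigma> \<noteq> 0\<close> L(1)[OF t] \<mu> by (simp add: field_simps power2_eq_square power3_eq_cube)
              also have "(L t)\<^sup>2 / \<mu> = t / L t"
                using L(1)[OF t] L(2)[OF t] \<mu> by (simp add: field_simps power2_eq_square power3_eq_cube)
              then have "\<sigma> * (1 - omega (?x t)) * (L t)\<^sup>2 / \<mu> = \<sigma> * (1 - omega (?x t)) * (t / L t)"
                by (metis times_divide_eq_right)
              finally have "\<sigma> ^ 3 * ((1 - omega (?x t)) / (?x t)\<^sup>2) = \<sigma> * (1 - omega (?x t)) * (t / L t)" .
              then show ?thesis by (simp only:) (simp add: algebra_simps diff_divide_distrib)
            qed
            then have "F t (\<sigma> / L t) = - (\<i> / 2) * of_real (\<sigma> / L t * omega (?x t)) * fourier P0 (\<sigma> / L t)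
              * (cis (t * (\<sigma> / L t)) * cis (- (t * (\<sigma> / L t)))) * (of_real t * osc_mean (- (\<sigma> ^ 3 * ((1 - omega (?x t)) / (?x t)\<^sup>2))))"
              unfolding F_def zeta_hat_eq[OF t] using elim by (simp add: indicator_def)
            then have "G t \<sigma> = - (\<i> / 2) * of_real (1 / (t powr (1/3) * L t) * (\<sigma> / L t * omega (?x t)) * t) * fourier P0 (\<sigma> / L t)
              * osc_mean (- (\<sigma> ^ 3 * ((1 - omega (?x t)) / (?x t)\<^sup>2)))"
              unfolding G_def by (simp add: cis_mult mult_ac)
            also have "1 / (t powr (1/3) * L t) * (\<sigma> / L t * omega (?x t)) * t = t / ((L t)\<^sup>2 * t powr (1/3)) * (\<sigma> * omega (?x t))"
              by (simp add: power2_eq_square mult_ac)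
            finally show ?case unfolding m scale[OF t] by simp
          qed
        qed
        ultimately show ?case by (simp add: Lim_transform_eventually)
      qed
    qed
  qed
  then have "((\<lambda>t. LINT \<sigma>|lborel. G (max 1 t) \<sigma>) \<longlongrightarrow> of_real (1 / \<mu> powr (2/3)) * fourier P0 0 * (LINT \<sigma>|lborel. diagonal_profile \<sigma>)) at_top"
    unfolding g_def by simp
  moreover have "eventually (\<lambda>t. (LINT \<sigma>|lborel. G (max 1 t) \<sigma>) = of_real (1 / t powr (1/3)) * (LINT \<xi>|lborel. F t \<xi>)) at_top"
    using eventually_ge_at_top[of 1]
  proof eventually_elim
    case (elim t)
    then have t: "t > 0" and m: "max 1 t = t" by auto
    \<comment> \<open>The affine substitution undoes the rescaling, and its factor cancels the
      Jacobian in \<open>G\<close>.\<close>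
    have "(LINT \<sigma>|lborel. G t \<sigma>) = \<bar>L t\<bar> *\<^sub>R (LINT \<xi>|lborel. G t (0 + L t * \<xi>))"
      using L(1)[OF t] by (intro lborel_integral_real_affine) auto
    also have "(LINT \<xi>|lborel. G t (0 + L t * \<xi>)) = of_real (1 / (t powr (1/3) * L t)) * (LINT \<xi>|lborel. F t \<xi>)"
      unfolding G_def using L(1)[OF t] by simp
    also have "\<bar>L t\<bar> *\<^sub>R \<dots> = of_real (1 / t powr (1/3)) * (LINT \<xi>|lborel. F t \<xi>)"
      using L(1)[OF t] t by (simp add: scaleR_conv_of_real)
    finally show ?case unfolding m .
  qed
  ultimately show ?thesis by (rule Lim_transform_eventually)
qed

text \<open>The reverse triangle inequality separates low from high frequencies; the high ones are
  at most the integral of \<open>zeta_bound\<close> with weight 1, uniformly in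
  \<open>t\<close>.\<close>

lemma zeta_R_diagonal_lower:
  assumes P0: "integrable lebesgue P0" "in_H1 P0" and \<mu>: "\<mu> > 0" and t: "t > 0"
  shows "cmod (LINT \<xi>|lborel. indicator {\<xi>. \<bar>sqrt \<mu> * \<xi>\<bar> \<le> 1} \<xi> *\<^sub>R (cis (t * \<xi>) * zeta_hat \<mu> P0 t \<xi>))
    - (LINT \<xi>|lborel. zeta_bound \<mu> P0 1 \<xi>) \<le> cmod (zeta_R \<mu> P0 t t)"
proof -
  define L where "L = (\<mu> * t) powr (1/3)"
  have L: "L > 0" "L ^ 3 = \<mu> * t" using t \<mu> by (auto simp: L_def powr_realpow[symmetric] powr_powr)
  have zi: "integrable lborel (zeta_hat \<mu> P0 t)"
    by (rule zeta_hat_integrable(1)[OF P0 \<mu> t L zero_less_one])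
  let ?S = "{\<xi>. \<bar>sqrt \<mu> * \<xi>\<bar> \<le> 1}"
  have ci: "integrable lborel (\<lambda>\<xi>. cis (t * \<xi>) * zeta_hat \<mu> P0 t \<xi>)"
    by (rule integrable_cis_mult[OF zi]) auto
  have i: "integrable lborel (\<lambda>\<xi>. indicator S \<xi> *\<^sub>R (cis (t * \<xi>) * zeta_hat \<mu> P0 t \<xi>))" if "S \<in> sets borel" for S
    using that by (intro integrable_mult_indicator ci) auto
  have S: "?S \<in> sets borel" "- ?S \<in> sets borel" by measurable
  have "zeta_R \<mu> P0 t t = (LINT \<xi>|lborel. cis (t * \<xi>) * zeta_hat \<mu> P0 t \<xi>)"
    unfolding zeta_R_eq_fint[OF P0(1) t] fint_def by (simp add: mult_ac)
  also have "\<dots> = (LINT \<xi>|lborel. indicator ?S \<xi> *\<^sub>R (cis (t * \<xi>) * zeta_hat \<mu> P0 t \<xi>) + indicator (- ?S) \<xi> *\<^sub>R (cis (t * \<xi>) * zeta_hat \<mu> P0 t \<xi>))"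
    by (intro Bochner_Integration.integral_cong) (auto simp: indicator_def)
  also have "\<dots> = (LINT \<xi>|lborel. indicator ?S \<xi> *\<^sub>R (cis (t * \<xi>) * zeta_hat \<mu> P0 t \<xi>)) + (LINT \<xi>|lborel. indicator (- ?S) \<xi> *\<^sub>R (cis (t * \<xi>) * zeta_hat \<mu> P0 t \<xi>))"
    by (intro Bochner_Integration.integral_add i S)
  also have "cmod \<dots> \<ge> cmod (LINT \<xi>|lborel. indicator ?S \<xi> *\<^sub>R (cis (t * \<xi>) * zeta_hat \<mu> P0 t \<xi>)) - cmod (LINT \<xi>|lborel. indicator (- ?S) \<xi> *\<^sub>R (cis (t * \<xi>) * zeta_hat \<mu> P0 t \<xi>))"
    by (rule norm_diff_ineq)
  moreover have "cmod (LINT \<xi>|lborel. indicator (- ?S) \<xi> *\<^sub>R (cis (t * \<xi>) * zeta_hat \<mu> P0 t \<xi>)) \<le> (LINT \<xi>|lborel. zeta_bound \<mu> P0 1 \<xi>)"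
  proof (rule Bochner_Integration.integral_norm_bound_integral[OF i[OF S(2)] zeta_bound_integral(1)[OF P0 \<mu> zero_less_one]])
    fix \<xi>
    show "norm (indicator (- ?S) \<xi> *\<^sub>R (cis (t * \<xi>) * zeta_hat \<mu> P0 t \<xi>)) \<le> zeta_bound \<mu> P0 1 \<xi>"
      using zeta_hat_high_bound[OF t \<mu> zero_less_one, of \<xi> P0] zeta_bound_nonneg[OF \<mu> zero_less_one, of P0 \<xi>]
      by (auto simp: indicator_def norm_mult zeta_bound_def)
  qed
  ultimately show ?thesis by simp
qed

lemma zeta_R_upper:
  assumes P0: "integrable lebesgue P0" "in_H1 P0" and \<mu>: "0 < \<mu>" "\<mu> \<le> m" and t: "t > 0" and nz: "fourier P0 0 \<noteq> 0"
  shows "Linf_norm (zeta_R \<mu> P0 t) \<le> ereal ((24 * m powr (1/3) + 12 * (2 * pi + 1 / (2 * pi)))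
    * (t powr (1/3) / \<mu> * L1_norm P0 + \<mu> powr (1/4) * H1_norm P0))"
proof -
  \<comment> \<open>A nonzero transform at 0 excludes \<open>P0\<close> = 0 almost everywhere;
    positivity of the norm is needed for the weight \<open>a\<close> below.\<close>
  have H: "H1_norm P0 > 0"
  proof -
    have P0m[measurable]: "P0 \<in> borel_measurable lebesgue" and sq: "integrable lebesgue (\<lambda>x. (cmod (P0 x))\<^sup>2)"
      using P0 by (auto simp: in_H1_def in_L2_def)
    have "(LINT x|lebesgue. (cmod (P0 x))\<^sup>2) \<noteq> 0"
    proof
      assume "(LINT x|lebesgue. (cmod (P0 x))\<^sup>2) = 0"
      then have "AE x in lebesgue. (cmod (P0 x))\<^sup>2 = 0"
        by (subst (asm) integral_nonneg_eq_0_iff_AE[OF sq]) auto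
      then have "AE x in lebesgue. cis (- (x * 0)) * P0 x = 0" by eventually_elim auto
      then have "(LINT x|lebesgue. cis (- (x * 0)) * P0 x) = 0" by (rule integral_eq_zero_AE)
      then show False using nz by (simp add: fourier_def)
    qed
    then have "(LINT x|lebesgue. (cmod (P0 x))\<^sup>2) > 0" by (simp add: less_le)
    then show ?thesis unfolding H1_norm_def by (intro real_sqrt_gt_zero add_pos_nonneg) auto
  qed
  define L where "L = (\<mu> * t) powr (1/3)"
  have L: "L > 0" "L ^ 3 = \<mu> * t" using t \<mu> by (auto simp: L_def powr_realpow[symmetric] powr_powr)
  \<comment> \<open>The surplus mu^(1/3) relative to t^(1/3) / mu is what turns into m^(1/3) in the
    constant.\<close>
  have L2: "t / L\<^sup>2 = \<mu> powr (1/3) * (t powr (1/3) / \<mu>)"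
  proof -
    have "L\<^sup>2 = \<mu> powr (2/3) * t powr (2/3)" using t \<mu> by (auto simp: L_def powr_realpow[symmetric] powr_powr powr_mult)
    moreover have "t powr (2/3) * t powr (1/3) = t" "\<mu> powr (2/3) * \<mu> powr (1/3) = \<mu>" using t \<mu> by (simp_all add: powr_add[symmetric])
    ultimately have "t / L\<^sup>2 = (t powr (2/3) * t powr (1/3)) / (\<mu> powr (2/3) * t powr (2/3))"
      and "\<mu> powr (1/3) * (t powr (1/3) / \<mu>) = \<mu> powr (1/3) * (t powr (1/3) / (\<mu> powr (2/3) * \<mu> powr (1/3)))"
      by simp_all
    then show ?thesis using t \<mu> by simp
  qed
  let ?q = "\<mu> powr (1/4)"
  \<comment> \<open>This weight balances the two high-frequency terms: both become multiples of
    mu^(1/4) times the H^1 norm.\<close>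
  define a where "a = H1_norm P0 / ?q"
  have a: "a > 0" using H \<mu> by (simp add: a_def)
  have q2: "?q * ?q = sqrt \<mu>" using \<mu> by (simp add: powr_add[symmetric] powr_half_sqrt)
  have "cmod (zeta_R \<mu> P0 t X) \<le> (24 * m powr (1/3) + 12 * (2 * pi + 1 / (2 * pi)))
    * (t powr (1/3) / \<mu> * L1_norm P0 + ?q * H1_norm P0)" for X
  proof -
    have L1: "L1_norm P0 \<ge> 0" by (simp add: L1_norm_def)
    have "cmod (zeta_R \<mu> P0 t X) \<le> (LINT \<xi>|lborel. cmod (zeta_hat \<mu> P0 t \<xi>))"
      unfolding zeta_R_eq_fint[OF P0(1) t] by (rule cmod_fint_le)
    also have "\<dots> \<le> 24 * L1_norm P0 * (t / L\<^sup>2) + (LINT \<xi>|lborel. zeta_bound \<mu> P0 a \<xi>)"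
      by (rule zeta_hat_integrable(2)[OF P0 \<mu>(1) t L a])
    also have "\<dots> \<le> 24 * L1_norm P0 * (t / L\<^sup>2) + 12 * (2 * pi * a * sqrt \<mu> + (H1_norm P0)\<^sup>2 / (2 * pi) / a)"
      by (intro add_left_mono zeta_bound_integral(2)[OF P0 \<mu>(1) a])
    also have "a * sqrt \<mu> = ?q * H1_norm P0" using \<mu> q2[symmetric] by (simp add: a_def)
    then have "2 * pi * a * sqrt \<mu> = 2 * pi * (?q * H1_norm P0)" by simp
    also have "(H1_norm P0)\<^sup>2 / (2 * pi) / a = 1 / (2 * pi) * (?q * H1_norm P0)"
      using H by (simp add: a_def power2_eq_square)
    also have "24 * L1_norm P0 * (t / L\<^sup>2) = 24 * \<mu> powr (1/3) * (t powr (1/3) / \<mu> * L1_norm P0)"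
      unfolding L2 by simp
    also have "\<dots> \<le> 24 * m powr (1/3) * (t powr (1/3) / \<mu> * L1_norm P0)"
      using \<mu> t L1 by (intro mult_right_mono mult_left_mono powr_mono2) auto
    also have "24 * m powr (1/3) * (t powr (1/3) / \<mu> * L1_norm P0) + 12 * (2 * pi * (?q * H1_norm P0) + 1 / (2 * pi) * (?q * H1_norm P0))
      \<le> (24 * m powr (1/3) + 12 * (2 * pi + 1 / (2 * pi))) * (t powr (1/3) / \<mu> * L1_norm P0 + ?q * H1_norm P0)"
    proof -
      have ineq: "A * x + B * y \<le> (A + B) * (x + y)" if "0 \<le> A" "0 \<le> B" "0 \<le> x" "0 \<le> y" for A B x y :: real
        using mult_nonneg_nonneg[OF that(1,4)] mult_nonneg_nonneg[OF that(2,3)] by (simp add: algebra_simps)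
      have eq: "12 * (2 * pi * (?q * H1_norm P0) + 1 / (2 * pi) * (?q * H1_norm P0)) = 12 * (2 * pi + 1 / (2 * pi)) * (?q * H1_norm P0)"
        by (simp only: distrib_right distrib_left mult.assoc)
      show ?thesis unfolding eq using \<mu> t L1 H by (intro ineq) auto
    qed
    finally show ?thesis by simp
  qed
  then show ?thesis
    by (intro Linf_norm_le continuous_zeta_R P0 t zeta_hat_integrable(1)[OF P0 \<mu>(1) t L zero_less_one])
qed

text \<open>The high-frequency remainder is bounded in \<open>t\<close>, so after division by
  t^(1/3) only the limit of the low-frequency part survives.\<close>

lemma zeta_R_lower:
  assumes P0: "integrable lebesgue P0" "in_H1 P0" and \<mu>: "0 < \<mu>"
  shows "Liminf at_top (\<lambda>t. Linf_norm (\<lambda>X. of_real (1 / t powr (1/3)) * zeta_R \<mu> P0 t X))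
    \<ge> ereal (diagonal_const / \<mu> powr (2/3) * cmod (fourier P0 0))"
proof -
  let ?I = "\<lambda>t. LINT \<xi>|lborel. indicator {\<xi>. \<bar>sqrt \<mu> * \<xi>\<bar> \<le> 1} \<xi> *\<^sub>R (cis (t * \<xi>) * zeta_hat \<mu> P0 t \<xi>)"
  let ?K = "LINT \<xi>|lborel. zeta_bound \<mu> P0 1 \<xi>"
  let ?l = "cmod (of_real (1 / \<mu> powr (2/3)) * fourier P0 0 * (LINT \<sigma>|lborel. diagonal_profile \<sigma>))"
  let ?u = "\<lambda>t. cmod (of_real (1 / t powr (1/3)) * ?I t) - 1 / t powr (1/3) * ?K"
  have "diagonal_const = Re (LINT \<sigma>|lborel. diagonal_profile \<sigma>)"
    unfolding diagonal_const_def by (rule integral_Re[OF diagonal_profile_integrable])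
  then have "diagonal_const \<le> cmod (LINT \<sigma>|lborel. diagonal_profile \<sigma>)" by (metis complex_Re_le_cmod)
  then have "diagonal_const / \<mu> powr (2/3) * cmod (fourier P0 0) \<le> cmod (LINT \<sigma>|lborel. diagonal_profile \<sigma>) / \<mu> powr (2/3) * cmod (fourier P0 0)"
    by (intro mult_right_mono divide_right_mono) auto
  then have "diagonal_const / \<mu> powr (2/3) * cmod (fourier P0 0) \<le> ?l" by (simp add: norm_mult norm_divide mult_ac)
  then have "ereal (diagonal_const / \<mu> powr (2/3) * cmod (fourier P0 0)) \<le> ereal ?l" by simp
  also have "ereal ?l = Liminf at_top (\<lambda>t. ereal (?u t))"
  proof (rule lim_imp_Liminf[symmetric])
    have "((\<lambda>t::real. 1 / t powr (1/3)) \<longlongrightarrow> 0) at_top" by real_asymp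
    then have "(?u \<longlongrightarrow> ?l - 0 * ?K) at_top"
      by (intro tendsto_diff tendsto_norm tendsto_mult tendsto_const low_frequency_limit[OF P0(1) \<mu>])
    then show "((\<lambda>t. ereal (?u t)) \<longlongrightarrow> ereal ?l) at_top" by simp
  qed simp
  also have "\<dots> \<le> Liminf at_top (\<lambda>t. Linf_norm (\<lambda>X. of_real (1 / t powr (1/3)) * zeta_R \<mu> P0 t X))"
  proof (rule Liminf_mono)
    show "\<forall>\<^sub>F t in at_top. ereal (?u t) \<le> Linf_norm (\<lambda>X. of_real (1 / t powr (1/3)) * zeta_R \<mu> P0 t X)"
      using eventually_gt_at_top[of 0]
    proof eventually_elim
      case (elim t)
      then have t: "t > 0" .
      define L where "L = (\<mu> * t) powr (1/3)"
      have L: "L > 0" "L ^ 3 = \<mu> * t" using t \<mu> by (auto simp: L_def powr_realpow[symmetric] powr_powr)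
      have "?u t = 1 / t powr (1/3) * (cmod (?I t) - ?K)"
        by (simp add: norm_mult norm_divide right_diff_distrib)
      also have "\<dots> \<le> 1 / t powr (1/3) * cmod (zeta_R \<mu> P0 t t)"
        by (intro mult_left_mono zeta_R_diagonal_lower P0 \<mu> t) auto
      also have "\<dots> = cmod (of_real (1 / t powr (1/3)) * zeta_R \<mu> P0 t t)" by (simp add: norm_mult norm_divide)
      finally have "ereal (?u t) \<le> ereal (cmod (of_real (1 / t powr (1/3)) * zeta_R \<mu> P0 t t))" by simp
      \<comment> \<open>Continuity makes the essential supremum dominate the value at X = t.\<close>
      also have "\<dots> \<le> Linf_norm (\<lambda>X. of_real (1 / t powr (1/3)) * zeta_R \<mu> P0 t X)"
        by (rule Linf_norm_ge) (intro continuous_on_mult continuous_on_const continuous_zeta_R P0 t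
          zeta_hat_integrable(1)[OF P0 \<mu> t L zero_less_one])
      finally show ?case .
    qed
  qed
  finally show ?thesis .
qed

theorem proposition3p14:
  shows "\<exists>(Cmax :: real \<Rightarrow> real) (C :: real). C > 0 \<and>
    (\<forall>(\<mu>\<^sub>m\<^sub>a\<^sub>x :: real) (\<mu> :: real) (P0 :: real \<Rightarrow> complex).
       0 < \<mu> \<longrightarrow> \<mu> \<le> \<mu>\<^sub>m\<^sub>a\<^sub>x \<longrightarrow>
       integrable lebesgue P0 \<longrightarrow> in_H1 P0 \<longrightarrow> fourier P0 0 \<noteq> 0 \<longrightarrow>
       (\<forall>t>0. Linf_norm (zeta_R \<mu> P0 t)
          \<le> ereal (Cmax \<mu>\<^sub>m\<^sub>a\<^sub>x * (t powr (1/3) / \<mu> * L1_norm P0 + \<mu> powr (1/4) * H1_norm P0))) \<and>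
       (in_H1 (\<lambda>X. of_real X * P0 X) \<longrightarrow>
          Liminf at_top (\<lambda>t. Linf_norm (\<lambda>X. of_real (1 / t powr (1/3)) * zeta_R \<mu> P0 t X))
            \<ge> ereal (C / \<mu> powr (2/3) * cmod (fourier P0 0))))"
  by (intro exI[of _ "\<lambda>m. 24 * m powr (1/3) + 12 * (2 * pi + 1 / (2 * pi))"] exI[of _ diagonal_const]
    conjI diagonal_const_pos allI impI zeta_R_upper zeta_R_lower)

end
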